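(* For integers $n\ge 0$ let $L_{n/2}=\frac{1}{2\pi}\int_{-\pi}^{\pi}\left|\frac{\sin((n+1)t/2)}{\sin(t/2)}\right|dt$, let $$c_1=\frac{8}{\pi^2}\sum_{k=1}^{\infty}\frac{\ln k}{4k^2-1}+\frac{4}{\pi^2}(\gamma+2\ln 2)$$ with $\gamma$ the Euler–Mascheroni constant, and let $$\mathrm{MC}_1(n)=\frac{\rho_1}{(n+1)^2+\varrho_1},\qquad \rho_1=\frac{12-\pi^2}{18\pi^2},\quad \varrho_1=\frac{7(-720+60\pi^2+\pi^4)}{600(-12+\pi^2)}.$$ Then for all integers $n\ge 0$, $$\frac{C_1}{(n+\frac{13}{8})^6}<L_{n/2}-\frac{4}{\pi^2}\ln(n+1)-c_1-\mathrm{MC}_1(n)<\frac{C_1}{(n+\frac58)^6},$$ where $$C_1=\frac{-7515244800+1252540800\pi^2-46937520\pi^4-65640\pi^6-23797\pi^8}{952560000\pi^2(-12+\pi^2)}>0.$$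
   Context: $\gamma=\lim_{n\to\infty}\left(\sum_{m=1}^n\frac1m-\ln n\right)$ is the Euler–Mascheroni constant. *)

theory Defs
  imports "HOL-Analysis.Analysis"
begin

text \<open>
  \<open>L_half n\<close> is the Lebesgue constant $L_{n/2}$. At \<open>t = 0\<close> the integrand takes the value \<open>0\<close>
  since \<open>x / 0 = 0\<close>; a single point does not affect the integral.
\<close>

definition L_half :: "nat \<Rightarrow> real" where
  "L_half n = 1 / (2 * pi) *
     integral {-pi..pi} (\<lambda>t. \<bar>sin ((real n + 1) * t / 2) / sin (t / 2)\<bar>)"

text \<open>The series starts at \<open>k = 1\<close>, hence the shift to \<open>Suc k\<close>.\<close>

definition c1 :: real where
  "c1 = 8 / pi\<^sup>2 * (\<Sum>k. ln (real (Suc k)) / (4 * (real (Suc k))\<^sup>2 - 1))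
      + 4 / pi\<^sup>2 * (euler_mascheroni + 2 * ln 2)"

definition rho1 :: real where
  "rho1 = (12 - pi\<^sup>2) / (18 * pi\<^sup>2)"

definition varrho1 :: real where
  "varrho1 = 7 * (-720 + 60 * pi\<^sup>2 + pi ^ 4) / (600 * (-12 + pi\<^sup>2))"

definition MC1 :: "nat \<Rightarrow> real" where
  "MC1 n = rho1 / ((real n + 1)\<^sup>2 + varrho1)"

definition C1 :: real where
  "C1 = (-7515244800 + 1252540800 * pi\<^sup>2 - 46937520 * pi ^ 4 - 65640 * pi ^ 6 - 23797 * pi ^ 8)
      / (952560000 * pi\<^sup>2 * (-12 + pi\<^sup>2))"

end

theory Submission
  imports Defs "HOL-Real_Asymp.Real_Asymp"
begin

text \<open>
  Write $N = n + 1$ and $O(m) = \sum_{j=1}^m 1/(2j-1)$. Inserting the Fourier series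
  $|\sin x| = \frac{8}{\pi} \sum_k \sin^2(kx)/(4k^2-1)$ into the integral and integrating
  $\sin^2(pu)/\sin u = \sum_{j \le p} \sin((2j-1)u)$ termwise gives Szego's formula
  $L_{n/2} = \frac{16}{\pi^2} \sum_k O(kN)/(4k^2-1)$. Since
  $O(m) = \frac12(\ln m + \gamma + 2 \ln 2) + e(m)$, what remains after subtracting
  $\frac{4}{\pi^2} \ln N + c_1$ is $\frac{16}{\pi^2} \sum_k e(kN)/(4k^2-1)$. The remainder $e$ is enveloped by its
  asymptotic series $\frac{1}{48m^2} - \frac{7}{1920m^4} + \frac{31}{16128m^6} - \frac{127}{61440m^8}$,
  and the sums $\sum_k 1/((4k^2-1)k^{2j})$ are moments of the same Fourier series. The first two terms
  of the resulting expansion in $N^{-2}$ agree with those of $\mathrm{MC}_1$, and $C_1$ is the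
  difference of the $N^{-6}$ coefficients. The interval between the two bounds is so wide that
  only $n = 0$ needs a sharper estimate, namely of $e(1)$.
\<close>

section \<open>The Fourier series of the absolute value of the sine\<close>

lemma four_square_minus_one: "k \<ge> 1 \<Longrightarrow> 4 * (real k)\<^sup>2 - 1 > 0"
proof -
  assume "k \<ge> 1"
  then have "(real k)\<^sup>2 \<ge> 1" by simp
  then show ?thesis by linarith
qed

text \<open>
  The left-hand side is the Wronskian of \<open>sin\<close> and the partial sum minus \<open>1/2\<close>. As it is \<open>O(1/K)\<close>,
  the quotient of the two becomes constant on \<open>(0, pi)\<close> in the limit.
\<close>

lemma cos_partial_sum_identity:
  "(\<Sum>k=1..K. - 2 * real k * sin (2 * real k * t) / (4 * (real k)\<^sup>2 - 1)) * sin t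
     - ((\<Sum>k=1..K. cos (2 * real k * t) / (4 * (real k)\<^sup>2 - 1)) - 1/2) * cos t
   = cos ((2 * real K + 1) * t) / (2 * (2 * real K + 1))"
proof (induction K)
  case 0
  show ?case by simp
next
  case (Suc K)
  define k where "k = real (Suc K)"
  define A where "A = cos (2 * k * t) * cos t"
  define B where "B = sin (2 * k * t) * sin t"
  have k: "k \<ge> 1" by (simp add: k_def)
  have c1: "cos ((2 * k + 1) * t) = A - B"
    by (simp add: A_def B_def cos_add distrib_right)
  have c2: "cos ((2 * real K + 1) * t) = A + B"
  proof -
    have "(2 * real K + 1) * t = 2 * k * t - t" by (simp add: k_def algebra_simps)
    then show ?thesis by (simp add: A_def B_def cos_diff)
  qed
  have fac: "4 * k\<^sup>2 - 1 = (2 * k - 1) * (2 * k + 1)" by (simp add: algebra_simps power2_eq_square)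
  have "(- 2 * k * sin (2 * k * t) / (4 * k\<^sup>2 - 1)) * sin t - cos (2 * k * t) / (4 * k\<^sup>2 - 1) * cos t
      = (- 2 * k * B - A) / ((2 * k - 1) * (2 * k + 1))"
    by (simp add: A_def B_def fac diff_divide_distrib)
  also have "\<dots> = (A - B) / (2 * (2 * k + 1)) - (A + B) / (2 * (2 * k - 1))"
  proof -
    have "2 * k + 1 \<noteq> 0" "2 * k - 1 \<noteq> 0" using k by auto
    then show ?thesis by (simp add: divide_simps) (simp add: algebra_simps)
  qed
  also have "2 * k - 1 = 2 * real K + 1" by (simp add: k_def)
  finally have step: "(- 2 * k * sin (2 * k * t) / (4 * k\<^sup>2 - 1)) * sin t - cos (2 * k * t) / (4 * k\<^sup>2 - 1) * cos t
      = (A - B) / (2 * (2 * k + 1)) - cos ((2 * real K + 1) * t) / (2 * (2 * real K + 1))"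
    by (simp add: c2)
  show ?case
    using Suc.IH step by (simp add: c1 flip: k_def del: of_nat_Suc) (simp add: c1 algebra_simps)
qed

text \<open>Partial fractions telescope. This is the value of the cosine series at 0, and its terms
  serve as the summable majorant in later comparisons.\<close>

lemma sums_inverse_four_square:
  "(\<lambda>k. 1 / (4 * (real (Suc k))\<^sup>2 - 1)) sums (1/2)"
proof -
  have "(\<lambda>k. 1 / (2 * (2 * real k + 1)) - 1 / (2 * (2 * real (Suc k) + 1))) sums (1 / (2 * (2 * real 0 + 1)) - 0)"
    by (rule telescope_sums') real_asymp
  moreover have "1 / (2 * (2 * real k + 1)) - 1 / (2 * (2 * real (Suc k) + 1)) = 1 / (4 * (real (Suc k))\<^sup>2 - 1)" for k
  proof -
    have "4 * (real (Suc k))\<^sup>2 - 1 = (2 * real k + 1) * (2 * real k + 3)"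
      by (simp add: algebra_simps power2_eq_square)
    then show ?thesis by (simp add: divide_simps) (simp add: algebra_simps)
  qed
  ultimately show ?thesis by simp
qed

text \<open>The value of the cosine series at \<open>pi/2\<close>, the base point of the argument
  below. By partial fractions each term is \<open>-1/2\<close> times the sum of two consecutive
  terms of the Leibniz series for \<open>pi/4\<close>.\<close>

lemma sums_alternating_four_square:
  "(\<lambda>k. (- 1) ^ Suc k / (4 * (real (Suc k))\<^sup>2 - 1)) sums (1/2 - pi/4)"
proof -
  have leib: "(\<lambda>k. (- 1) ^ k / (2 * real k + 1)) sums (pi / 4)"
  proof -
    have "summable (\<lambda>k. (- 1) ^ k * (1 / real (k * 2 + 1) * 1 ^ (k * 2 + 1)) :: real)"
      by (rule summable_arctan_series) auto
    then have "summable (\<lambda>k. (- 1) ^ k / (2 * real k + 1) :: real)" by (simp add: mult.commute add.commute)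
    moreover have "(\<Sum>k. (- 1) ^ k / (2 * real k + 1)) = pi / 4"
      using pi_series by (simp add: mult.commute add.commute)
    ultimately show ?thesis by (simp add: sums_iff)
  qed
  then have "(\<lambda>k. (- 1) ^ Suc k / (2 * real (Suc k) + 1)) sums (pi / 4 - 1)"
    by (subst sums_Suc_iff) simp
  from sums_add[OF leib this] have "(\<lambda>k. (- 1) ^ k / (2 * real k + 1) + (- 1) ^ Suc k / (2 * real (Suc k) + 1)) sums (pi / 2 - 1)"
    by simp
  from sums_mult[OF this, of "-1/2"]
  have "(\<lambda>k. (-1/2) * ((- 1) ^ k / (2 * real k + 1) + (- 1) ^ Suc k / (2 * real (Suc k) + 1))) sums (1/2 - pi / 4)"
    by (simp add: algebra_simps)
  moreover have "(-1/2) * ((- 1) ^ k / (2 * real k + 1) + (- 1) ^ Suc k / (2 * real (Suc k) + 1))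
      = (- 1) ^ Suc k / (4 * (real (Suc k))\<^sup>2 - 1)" (is "?a k = ?b k") for k
  proof -
    have "4 * (real (Suc k))\<^sup>2 - 1 = (2 * real k + 1) * (2 * real k + 3)"
      by (simp add: algebra_simps power2_eq_square)
    then show ?thesis by (simp add: divide_simps) (simp add: algebra_simps)
  qed
  then have "?a = ?b" by (rule ext)
  ultimately show ?thesis by simp
qed

lemma summable_cos_four_square: "summable (\<lambda>k. cos (x k) / (4 * (real (Suc k))\<^sup>2 - 1))"
proof (rule summable_comparison_test'[OF sums_summable[OF sums_inverse_four_square]])
  fix k :: nat
  have "4 * (real (Suc k))\<^sup>2 - 1 > 0" by (rule four_square_minus_one) simp
  then show "norm (cos (x k) / (4 * (real (Suc k))\<^sup>2 - 1)) \<le> 1 / (4 * (real (Suc k))\<^sup>2 - 1)"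
    by (simp add: abs_mult divide_simps)
qed

text \<open>The quotient \<open>H K\<close> of the partial sum minus \<open>1/2\<close> by
  \<open>sin\<close> has a derivative of size \<open>O(1/K)\<close> between \<open>x\<close> and
  \<open>pi/2\<close>. By the mean value inequality its limits at both points agree, and at
  \<open>pi/2\<close> the limit is \<open>- pi/4\<close>.\<close>

lemma fourier_sin_open_interval:
  assumes "0 < x" "x < pi"
  shows "(\<Sum>k. cos (2 * real (Suc k) * x) / (4 * (real (Suc k))\<^sup>2 - 1)) = 1/2 - pi/4 * sin x"
proof -
  define G where "G K t = (\<Sum>k=1..K. cos (2 * real k * t) / (4 * (real k)\<^sup>2 - 1))" for K t
  define H where "H K t = (G K t - 1/2) / sin t" for K t
  define G' where "G' K t = (\<Sum>k=1..K. - 2 * real k * sin (2 * real k * t) / (4 * (real k)\<^sup>2 - 1))" for K t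
  have dG: "(G K has_real_derivative G' K t) (at t)" for K t
    unfolding G_def[abs_def] G'_def
    using four_square_minus_one by (force intro!: derivative_eq_intros sum.cong)
  have sx: "sin x > 0" using assms sin_gt_zero by blast
  \<comment> \<open>The segment between \<open>x\<close> and \<open>pi/2\<close>, whichever is
    larger. On it \<open>sin\<close> is smallest at \<open>x\<close>, which bounds the derivative of
    \<open>H K\<close> uniformly.\<close>
  define J where "J = {min x (pi/2)..max x (pi/2)}"
  have sJ: "sin t \<ge> sin x" if "t \<in> J" for t
  proof (cases "x \<le> pi/2")
    case True
    then have "x \<le> t" "t \<le> pi/2" using that by (auto simp: J_def)
    then show ?thesis using assms True by (subst sin_mono_le_eq) auto
  next
    case False
    then have t: "t \<le> x" "pi/2 \<le> t" using that by (auto simp: J_def)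
    have "sin (pi - x) \<le> sin (pi - t)" using assms False t by (subst sin_mono_le_eq) auto
    then show ?thesis by simp
  qed
  have dH: "(H K has_real_derivative cos ((2 * real K + 1) * t) / (2 * (2 * real K + 1)) / (sin t)\<^sup>2) (at t)"
    if "t \<in> J" for K t
  proof -
    have "sin t \<noteq> 0" using sJ[OF that] sx by auto
    then have "(H K has_real_derivative (G' K t * sin t - (G K t - 1/2) * cos t) / (sin t)\<^sup>2) (at t)"
      unfolding H_def[abs_def] by (auto intro!: derivative_eq_intros dG simp: power2_eq_square)
    \<comment> \<open>The numerator given by the quotient rule is the Wronskian evaluated
      above.\<close>
    then show ?thesis
      using cos_partial_sum_identity[of t K] by (simp add: G_def G'_def)
  qed
  have bound: "norm (H K x - H K (pi/2)) \<le> 1 / (2 * (2 * real K + 1)) / (sin x)\<^sup>2 * norm (x - pi/2)" for K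
  proof (rule field_differentiable_bound[where S = J and f = "H K"])
    show "convex J" by (simp add: J_def)
    show "(H K has_real_derivative cos ((2 * real K + 1) * t) / (2 * (2 * real K + 1)) / (sin t)\<^sup>2) (at t within J)"
      if "t \<in> J" for t using dH[OF that] by (rule DERIV_subset) simp
    show "norm (cos ((2 * real K + 1) * t) / (2 * (2 * real K + 1)) / (sin t)\<^sup>2) \<le> 1 / (2 * (2 * real K + 1)) / (sin x)\<^sup>2"
      if "t \<in> J" for t
    proof -
      have "(sin x)\<^sup>2 \<le> (sin t)\<^sup>2" using sJ[OF that] sx by (intro power_mono) auto
      moreover have "\<bar>cos ((2 * real K + 1) * t)\<bar> \<le> 1" by simp
      ultimately show ?thesis using sx
        by (auto simp: abs_mult intro!: frac_le)
    qed
  qed (auto simp: J_def)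
  have lim0: "(\<lambda>K. H K x - H K (pi/2)) \<longlonglongrightarrow> 0"
  proof (rule Lim_null_comparison[OF always_eventually])
    show "\<forall>K. norm (H K x - H K (pi/2)) \<le> 1 / (2 * (2 * real K + 1)) * (norm (x - pi/2) / (sin x)\<^sup>2)"
      using bound by (simp add: field_simps)
    have "(\<lambda>K. 1 / (2 * (2 * real K + 1))) \<longlonglongrightarrow> 0" by real_asymp
    from tendsto_mult_left_zero[OF this]
    show "(\<lambda>K. 1 / (2 * (2 * real K + 1)) * (norm (x - pi/2) / (sin x)\<^sup>2)) \<longlonglongrightarrow> 0" .
  qed
  have GL: "(\<lambda>K. G K t) \<longlonglongrightarrow> (\<Sum>k. cos (2 * real (Suc k) * t) / (4 * (real (Suc k))\<^sup>2 - 1))" for t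
  proof -
    have "G K t = (\<Sum>k<K. cos (2 * real (Suc k) * t) / (4 * (real (Suc k))\<^sup>2 - 1))" for K
      unfolding G_def by (simp add: sum.atLeast1_atMost_eq)
    then show ?thesis
      using summable_LIMSEQ[OF summable_cos_four_square[of "\<lambda>k. 2 * real (Suc k) * t"]] by simp
  qed
  have "cos (2 * real (Suc k) * (pi/2)) = (- 1) ^ Suc k" for k
  proof -
    have "2 * real (Suc k) * (pi/2) = real (Suc k) * pi" by simp
    then show ?thesis using cos_npi[of "Suc k"] by (simp only:)
  qed
  then have half: "(\<Sum>k. cos (2 * real (Suc k) * (pi/2)) / (4 * (real (Suc k))\<^sup>2 - 1)) = 1/2 - pi/4"
    using sums_unique[OF sums_alternating_four_square] by simp
  define g where "g = (\<Sum>k. cos (2 * real (Suc k) * x) / (4 * (real (Suc k))\<^sup>2 - 1))"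
  have "(\<lambda>K. H K x - H K (pi/2)) \<longlonglongrightarrow> (g - 1/2) / sin x - ((1/2 - pi/4) - 1/2) / sin (pi/2)"
    unfolding H_def using sx half GL[of x] GL[of "pi/2"] g_def
    by (intro tendsto_intros) auto
  from LIMSEQ_unique[OF this lim0] have "(g - 1/2) / sin x = - pi/4" by simp
  then have "g = 1/2 - pi/4 * sin x" using sx by (simp add: field_simps)
  then show ?thesis by (simp only: g_def)
qed

text \<open>Both sides have period \<open>pi\<close>, so \<open>x\<close> reduces to
  \<open>y\<close> in \<open>[0, pi)\<close>. The point \<open>y = 0\<close>, which the open
  interval leaves out, is the telescoping series.\<close>

lemma fourier_abs_sin:
  "(\<Sum>k. cos (2 * real (Suc k) * x) / (4 * (real (Suc k))\<^sup>2 - 1)) = 1/2 - pi/4 * \<bar>sin x\<bar>"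
proof -
  define m where "m = \<lfloor>x / pi\<rfloor>"
  define y where "y = x - of_int m * pi"
  have fl: "of_int m \<le> x / pi" "x / pi < of_int m + 1" unfolding m_def by linarith+
  have y: "0 \<le> y" "y < pi" using fl by (auto simp: y_def field_simps)
  have cosxy: "cos (2 * real (Suc k) * x) = cos (2 * real (Suc k) * y)" for k
  proof -
    have "2 * real (Suc k) * x = 2 * real (Suc k) * y + 2 * pi * of_int (int (Suc k) * m)"
      by (simp add: y_def algebra_simps)
    then show ?thesis by (simp only: cos_add cos_int_2pin sin_int_2pin mult_1_right mult_zero_right diff_zero)
  qed
  have "\<bar>sin x\<bar> = \<bar>sin y\<bar>"
  proof -
    have s0: "sin (of_int m * pi) = 0" using sin_zero_iff_int2 by blast
    then have "\<bar>cos (of_int m * pi)\<bar> = 1"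
      using sin_cos_squared_add[of "of_int m * pi"] by (auto simp: power2_eq_1_iff)
    moreover have "x = y + of_int m * pi" by (simp add: y_def)
    ultimately show ?thesis using s0 by (simp only: sin_add) (simp add: abs_mult)
  qed
  moreover have "sin y \<ge> 0" using y by (intro sin_ge_zero) auto
  moreover have "(\<Sum>k. cos (2 * real (Suc k) * y) / (4 * (real (Suc k))\<^sup>2 - 1)) = 1/2 - pi/4 * sin y"
  proof (cases "y = 0")
    case True
    then show ?thesis using sums_unique[OF sums_inverse_four_square] by simp
  next
    case False
    then show ?thesis using y by (intro fourier_sin_open_interval) auto
  qed
  ultimately show ?thesis by (simp only: cosxy abs_of_nonneg)
qed

section \<open>Sums of reciprocals of odd numbers\<close>

definition odd_harm :: "nat \<Rightarrow> real" where
  "odd_harm m = (\<Sum>j<m. 1 / (2 * real j + 1))"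

definition odd_harm_rem :: "nat \<Rightarrow> real" where
  "odd_harm_rem m = odd_harm m - (ln (real m) + euler_mascheroni + 2 * ln 2) / 2"

lemma odd_harm_eq_harm: "odd_harm m = harm (2 * m) - harm m / 2"
proof (induction m)
  case 0
  show ?case by (simp add: odd_harm_def harm_def)
next
  case (Suc m)
  have "harm (2 * Suc m) = harm (2 * m) + 1 / (2 * real m + 1) + 1 / (2 * (real m + 1))"
    by (simp add: harm_Suc inverse_eq_divide add.commute)
  moreover have "harm (Suc m) = harm m + 1 / (real m + 1)"
    by (simp add: harm_Suc inverse_eq_divide add.commute)
  ultimately show ?case using Suc by (simp add: odd_harm_def add_divide_distrib)
qed

text \<open>In terms of harmonic numbers the limit is gamma - gamma/2 - gamma/2 = 0; the
  \<open>ln 2\<close> in the definition is absorbed by \<open>ln (2 * m)\<close>.\<close>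

lemma odd_harm_rem_tendsto_0: "odd_harm_rem \<longlonglongrightarrow> 0"
proof -
  have lim: "(\<lambda>m. harm m - ln (real m)) \<longlonglongrightarrow> euler_mascheroni"
    by (rule euler_mascheroni_LIMSEQ)
  have "filterlim (\<lambda>m::nat. 2 * m) sequentially sequentially"
    by (rule filterlim_subseq) (simp add: strict_mono_def)
  from filterlim_compose[OF lim this]
  have "(\<lambda>m. (harm (2 * m) - ln (real (2 * m))) - (harm m - ln (real m)) / 2
      - euler_mascheroni / 2) \<longlonglongrightarrow> euler_mascheroni - euler_mascheroni / 2 - euler_mascheroni / (2::real)"
    by (intro tendsto_intros lim) auto
  then have "(\<lambda>m. (harm (2 * m) - ln (real (2 * m))) - (harm m - ln (real m)) / 2
      - euler_mascheroni / 2) \<longlonglongrightarrow> (0::real)" by simp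
  moreover have "\<forall>\<^sub>F m in sequentially. (harm (2 * m) - ln (real (2 * m))) - (harm m - ln (real m)) / 2
      - euler_mascheroni / 2 = odd_harm_rem m"
    using eventually_gt_at_top[of 0]
  proof eventually_elim
    case (elim m)
    then have "ln (real (2 * m)) = ln 2 + ln (real m)" by (simp add: ln_mult)
    then show ?case by (simp add: odd_harm_rem_def odd_harm_eq_harm field_simps)
  qed
  ultimately show ?thesis by (rule Lim_transform_eventually)
qed

text \<open>Taking a difference reduces the sum to one term and cancels both constants. What is left
  is elementary in \<open>m\<close> and can be compared with the differences of \<open>rem3\<close>
  and \<open>rem4\<close>.\<close>

lemma odd_harm_rem_diff:
  "odd_harm_rem m - odd_harm_rem (Suc m)
    = (ln (real m + 1) - ln (real m)) / 2 - 1 / (2 * real m + 1)"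
  by (simp add: odd_harm_rem_def odd_harm_def field_simps add.commute)

section \<open>Comparison principles for functions that vanish at infinity\<close>

lemma le_of_diff_le_tendsto_0:
  fixes f g :: "nat \<Rightarrow> real"
  assumes "f \<longlonglongrightarrow> 0" "g \<longlonglongrightarrow> 0"
    and "\<And>k. k \<ge> m \<Longrightarrow> f k - f (Suc k) \<le> g k - g (Suc k)"
  shows "f m \<le> g m"
proof -
  have "decseq (\<lambda>k. g (m + k) - f (m + k))"
    using assms(3) by (intro decseq_SucI) (smt (verit) add_Suc_right le_add1)
  moreover have "(\<lambda>k. g (m + k) - f (m + k)) \<longlonglongrightarrow> 0 - 0"
    using assms(1,2) by (intro tendsto_diff) (simp_all add: LIMSEQ_ignore_initial_segment add.commute[of m])
  ultimately have "0 - 0 \<le> g (m + 0) - f (m + 0)" by (rule decseq_ge)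
  then show ?thesis by simp
qed

text \<open>A nonincreasing function lies above its limit. This reduces an inequality with
  logarithms to the sign of a rational function, its derivative.\<close>

lemma nonneg_of_deriv_nonpos_tendsto_0:
  fixes f f' :: "real \<Rightarrow> real"
  assumes "(f \<longlongrightarrow> 0) at_top"
    and "\<And>y. y \<ge> x \<Longrightarrow> (f has_real_derivative f' y) (at y)"
    and "\<And>y. y \<ge> x \<Longrightarrow> f' y \<le> 0"
  shows "f x \<ge> 0"
proof (rule tendsto_upperbound[OF assms(1)])
  show "\<forall>\<^sub>F y in at_top. f y \<le> f x"
    using eventually_ge_at_top[of x]
  proof eventually_elim
    case (elim y)
    show ?case
      using assms(2,3) by (intro DERIV_nonpos_imp_nonincreasing[OF elim]) blast
  qed
qed simp

text \<open>
  Truncations of the asymptotic series of \<open>odd_harm_rem\<close>, obtained from those of \<open>harm (2 * m)\<close>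
  and \<open>harm m\<close>.
\<close>

definition rem3 :: "real \<Rightarrow> real" where
  "rem3 x = 1 / (48 * x ^ 2) - 7 / (1920 * x ^ 4) + 31 / (16128 * x ^ 6)"

definition rem4 :: "real \<Rightarrow> real" where
  "rem4 x = rem3 x - 127 / (61440 * x ^ 8)"

text \<open>Serves to clear denominators while the reciprocals remain variables \<open>u\<close>,
  \<open>v\<close>, \<open>w\<close> tied to \<open>y\<close> only by equations such as
  \<open>u * y = 1\<close>.\<close>

lemma power_mult_power_inverse:
  fixes a b :: real
  assumes "a * b = 1" "i \<le> n"
  shows "a ^ i * b ^ n = b ^ (n - i)"
proof -
  have "a ^ i * b ^ n = (a * b) ^ i * b ^ (n - i)"
    using assms(2) by (simp add: power_mult_distrib mult.assoc flip: power_add)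
  then show ?thesis using assms(1) by simp
qed

text \<open>The derivative is given as a power of \<open>1 / y\<close>, the form in which the
  numerator identities below take it.\<close>

lemma DERIV_inverse_power:
  fixes y :: real
  assumes "y \<noteq> 0"
  shows "((\<lambda>y. c / (d * y ^ n)) has_real_derivative - (real n * c / d) * (1 / y) ^ Suc n) (at y)"
proof -
  have "((\<lambda>y. e * inverse (y ^ n)) has_real_derivative
      e * (- (inverse (y ^ n) * (real n * y ^ (n - 1)) * inverse (y ^ n)))) (at y)" for e
    using assms by (auto intro!: derivative_eq_intros)
  from this[of "c / d"] have "((\<lambda>y. (c / d) * inverse (y ^ n)) has_real_derivative
      (c / d) * (- (inverse (y ^ n) * (real n * y ^ (n - 1)) * inverse (y ^ n)))) (at y)" .
  moreover have "(c / d) * (- (inverse (y ^ n) * (real n * y ^ (n - 1)) * inverse (y ^ n)))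
      = - (real n * c / d) * (1 / y) ^ Suc n"
    using assms by (cases n) (simp_all add: power_divide divide_simps)
  moreover have "(\<lambda>y. c / (d * y ^ n)) = (\<lambda>y. (c / d) * inverse (y ^ n))"
    by (simp add: fun_eq_iff divide_inverse)
  ultimately show ?thesis by simp
qed

lemma DERIV_rem3:
  assumes "y \<noteq> 0"
  shows "(rem3 has_real_derivative
    - 1 / 24 * (1 / y) ^ 3 + 7 / 480 * (1 / y) ^ 5 - 31 / 2688 * (1 / y) ^ 7) (at y)"
  using DERIV_add[OF DERIV_diff[OF DERIV_inverse_power[OF assms, of 1 48 2]
      DERIV_inverse_power[OF assms, of 7 1920 4]] DERIV_inverse_power[OF assms, of 31 16128 6]]
  unfolding rem3_def[abs_def] by simp

lemma DERIV_rem4: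
  assumes "y \<noteq> 0"
  shows "(rem4 has_real_derivative
    - 1 / 24 * (1 / y) ^ 3 + 7 / 480 * (1 / y) ^ 5 - 31 / 2688 * (1 / y) ^ 7 + 127 / 7680 * (1 / y) ^ 9) (at y)"
  using DERIV_diff[OF DERIV_rem3[OF assms] DERIV_inverse_power[OF assms, of 127 61440 8]]
  unfolding rem4_def[abs_def] by simp

text \<open>The first factor is the derivative of the gap in \<open>rem3_diff\<close>, the second
  the common denominator. Each power of a reciprocal is first paired with its own factor of the
  denominator, and only then is everything expanded. The asymptotic terms cancel the high powers of
  \<open>y\<close>; what remains has coefficients of one sign, so its sign is evident for
  \<open>y > 0\<close>.\<close>

lemma rem3_deriv_numerator:
  fixes y :: real
  assumes "u * y = 1" "v * (y + 1) = 1" "w * (2 * y + 1) = 1"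
  shows "((- 1 / 24 * u ^ 3 + 7 / 480 * u ^ 5 - 31 / 2688 * u ^ 7)
      - (- 1 / 24 * v ^ 3 + 7 / 480 * v ^ 5 - 31 / 2688 * v ^ 7)
      - (v - u) / 2 - 2 * w ^ 2) * (y^7 * (y + 1)^7 * (2 * y + 1)^2)
    = - (31/2688 + 341/2688 * y + 2673/4480 * y^2 + 2947/1920 * y^3
    + 4331/1920 * y^4 + 1143/640 * y^5 + 381/640 * y^6)"
proof -
  let ?Q = "y + 1" and ?W = "2 * y + 1"
  have u: "u * y ^ 7 = y ^ 6" "u ^ 3 * y ^ 7 = y ^ 4" "u ^ 5 * y ^ 7 = y ^ 2" "u ^ 7 * y ^ 7 = 1"
    using power_mult_power_inverse[OF assms(1), of 1 7]
      power_mult_power_inverse[OF assms(1), of 3 7]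
      power_mult_power_inverse[OF assms(1), of 5 7]
      power_mult_power_inverse[OF assms(1), of 7 7] by simp_all
  have v: "v * ?Q ^ 7 = ?Q ^ 6"
    "v ^ 3 * ?Q ^ 7 = ?Q ^ 4"
    "v ^ 5 * ?Q ^ 7 = ?Q ^ 2"
    "v ^ 7 * ?Q ^ 7 = 1"
    using power_mult_power_inverse[OF assms(2), of 1 7]
      power_mult_power_inverse[OF assms(2), of 3 7]
      power_mult_power_inverse[OF assms(2), of 5 7]
      power_mult_power_inverse[OF assms(2), of 7 7] by simp_all
  have w: "w ^ 2 * ?W ^ 2 = 1" using power_mult_power_inverse[OF assms(3), of 2 2] by simp
  have "((- 1 / 24 * u ^ 3 + 7 / 480 * u ^ 5 - 31 / 2688 * u ^ 7)
      - (- 1 / 24 * v ^ 3 + 7 / 480 * v ^ 5 - 31 / 2688 * v ^ 7)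
      - (v - u) / 2 - 2 * w ^ 2) * (y^7 * ?Q^7 * ?W^2)
    = (- 1 / 24 * (u ^ 3 * y ^ 7) + 7 / 480 * (u ^ 5 * y ^ 7) - 31 / 2688 * (u ^ 7 * y ^ 7) + u * y ^ 7 / 2) * (?Q^7 * ?W^2)
      - (- 1 / 24 * (v ^ 3 * ?Q ^ 7) + 7 / 480 * (v ^ 5 * ?Q ^ 7) - 31 / 2688 * (v ^ 7 * ?Q ^ 7) + v * ?Q ^ 7 / 2) * (y^7 * ?W^2)
      - 2 * (w ^ 2 * ?W ^ 2) * (y^7 * ?Q^7)"
    by (simp only: ring_distribs diff_divide_distrib) (simp add: mult_ac)
  also have "\<dots> = (- 1 / 24 * y ^ 4 + 7 / 480 * y ^ 2 - 31 / 2688 + y ^ 6 / 2) * (?Q^7 * ?W^2)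
      - (- 1 / 24 * ?Q ^ 4 + 7 / 480 * ?Q ^ 2 - 31 / 2688 + ?Q ^ 6 / 2) * (y^7 * ?W^2)
      - 2 * (y^7 * ?Q^7)"
    unfolding u v w by simp
  also have "\<dots> = - (31/2688 + 341/2688 * y + 2673/4480 * y^2 + 2947/1920 * y^3
    + 4331/1920 * y^4 + 1143/640 * y^5 + 381/640 * y^6)"
    by (simp add: algebra_simps eval_nat_numeral add_divide_distrib diff_divide_distrib)
  finally show ?thesis .
qed

text \<open>The gap \<open>f\<close> between the two sides tends to 0 at infinity, and its
  derivative is a rational function that is nonpositive for \<open>y > 0\<close>.\<close>

lemma rem3_diff:
  fixes x :: real
  assumes "x > 0"
  shows "(ln (x + 1) - ln x) / 2 - 1 / (2 * x + 1) \<le> rem3 x - rem3 (x + 1)"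
proof -
  define f where "f y = rem3 y - rem3 (y + 1) - ((ln (y + 1) - ln y) / 2 - 1 / (2 * y + 1))" for y :: real
  define f' where "f' y = - (31/2688 + 341/2688 * y + 2673/4480 * y^2 + 2947/1920 * y^3
    + 4331/1920 * y^4 + 1143/640 * y^5 + 381/640 * y^6)
    / (y^7 * (y + 1)^7 * (2 * y + 1)^2)" for y :: real
  have "f x \<ge> 0"
  proof (rule nonneg_of_deriv_nonpos_tendsto_0[where f = f and f' = f' and x = x])
    show "(f \<longlongrightarrow> 0) at_top" unfolding f_def rem3_def by real_asymp
  next
    fix y :: real assume "y \<ge> x"
    then have y: "y > 0" using assms by simp
    have "31/2688 + 341/2688 * y + 2673/4480 * y^2 + 2947/1920 * y^3
    + 4331/1920 * y^4 + 1143/640 * y^5 + 381/640 * y^6 \<ge> 0"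
      using y by (intro add_nonneg_nonneg mult_nonneg_nonneg zero_le_power) auto
    then show "f' y \<le> 0" using y unfolding f'_def by (intro divide_nonpos_nonneg) (simp only: neg_le_0_iff_le, simp)
    define u v w where uvw: "u = 1 / y" "v = 1 / (y + 1)" "w = 1 / (2 * y + 1)"
    have inv: "u * y = 1" "v * (y + 1) = 1" "w * (2 * y + 1) = 1" using y by (auto simp: uvw)
    have "(f has_real_derivative ((- 1 / 24 * u ^ 3 + 7 / 480 * u ^ 5 - 31 / 2688 * u ^ 7)
      - (- 1 / 24 * v ^ 3 + 7 / 480 * v ^ 5 - 31 / 2688 * v ^ 7)
      - (v - u) / 2 - 2 * w ^ 2)) (at y)"
      unfolding f_def uvw using y
      by (auto intro!: derivative_eq_intros DERIV_rem3 iffD1[OF DERIV_shift, OF DERIV_rem3]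
          simp: power2_eq_square diff_divide_distrib) (simp add: divide_simps)
    also have "((- 1 / 24 * u ^ 3 + 7 / 480 * u ^ 5 - 31 / 2688 * u ^ 7)
      - (- 1 / 24 * v ^ 3 + 7 / 480 * v ^ 5 - 31 / 2688 * v ^ 7)
      - (v - u) / 2 - 2 * w ^ 2) = f' y"
    proof -
      have "(y^7 * (y + 1)^7 * (2 * y + 1)^2) \<noteq> 0" using y by auto
      then show ?thesis using rem3_deriv_numerator[OF inv] unfolding f'_def by (simp add: eq_divide_eq)
    qed
    finally show "(f has_real_derivative f' y) (at y)" .
  qed
  then show ?thesis by (simp add: f_def)
qed

text \<open>The same computation with one more term of the series. The remaining coefficients are
  now positive, which is why \<open>rem4\<close> bounds from the other side.\<close>

lemma rem4_deriv_numerator: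
  fixes y :: real
  assumes "u * y = 1" "v * (y + 1) = 1" "w * (2 * y + 1) = 1"
  shows "((- 1 / 24 * u ^ 3 + 7 / 480 * u ^ 5 - 31 / 2688 * u ^ 7 + 127 / 7680 * u ^ 9)
      - (- 1 / 24 * v ^ 3 + 7 / 480 * v ^ 5 - 31 / 2688 * v ^ 7 + 127 / 7680 * v ^ 9)
      - (v - u) / 2 - 2 * w ^ 2) * (y^9 * (y + 1)^9 * (2 * y + 1)^2)
    = (127/7680 + 1651/7680 * y + 523/420 * y^2 + 56659/13440 * y^3
    + 246199/26880 * y^4 + 352643/26880 * y^5 + 163103/13440 * y^6 + 2555/384 * y^7 + 2555/1536 * y^8)"
proof -
  let ?Q = "y + 1" and ?W = "2 * y + 1"
  have u: "u * y ^ 9 = y ^ 8"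
    "u ^ 3 * y ^ 9 = y ^ 6"
    "u ^ 5 * y ^ 9 = y ^ 4"
    "u ^ 7 * y ^ 9 = y ^ 2"
    "u ^ 9 * y ^ 9 = 1"
    using power_mult_power_inverse[OF assms(1), of 1 9]
      power_mult_power_inverse[OF assms(1), of 3 9]
      power_mult_power_inverse[OF assms(1), of 5 9]
      power_mult_power_inverse[OF assms(1), of 7 9]
      power_mult_power_inverse[OF assms(1), of 9 9] by simp_all
  have v: "v * ?Q ^ 9 = ?Q ^ 8"
    "v ^ 3 * ?Q ^ 9 = ?Q ^ 6"
    "v ^ 5 * ?Q ^ 9 = ?Q ^ 4"
    "v ^ 7 * ?Q ^ 9 = ?Q ^ 2"
    "v ^ 9 * ?Q ^ 9 = 1"
    using power_mult_power_inverse[OF assms(2), of 1 9]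
      power_mult_power_inverse[OF assms(2), of 3 9]
      power_mult_power_inverse[OF assms(2), of 5 9]
      power_mult_power_inverse[OF assms(2), of 7 9]
      power_mult_power_inverse[OF assms(2), of 9 9] by simp_all
  have w: "w ^ 2 * ?W ^ 2 = 1" using power_mult_power_inverse[OF assms(3), of 2 2] by simp
  have "((- 1 / 24 * u ^ 3 + 7 / 480 * u ^ 5 - 31 / 2688 * u ^ 7 + 127 / 7680 * u ^ 9)
      - (- 1 / 24 * v ^ 3 + 7 / 480 * v ^ 5 - 31 / 2688 * v ^ 7 + 127 / 7680 * v ^ 9)
      - (v - u) / 2 - 2 * w ^ 2) * (y^9 * ?Q^9 * ?W^2)
    = (- 1 / 24 * (u ^ 3 * y ^ 9) + 7 / 480 * (u ^ 5 * y ^ 9) - 31 / 2688 * (u ^ 7 * y ^ 9) + 127 / 7680 * (u ^ 9 * y ^ 9) + u * y ^ 9 / 2) * (?Q^9 * ?W^2)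
      - (- 1 / 24 * (v ^ 3 * ?Q ^ 9) + 7 / 480 * (v ^ 5 * ?Q ^ 9) - 31 / 2688 * (v ^ 7 * ?Q ^ 9) + 127 / 7680 * (v ^ 9 * ?Q ^ 9) + v * ?Q ^ 9 / 2) * (y^9 * ?W^2)
      - 2 * (w ^ 2 * ?W ^ 2) * (y^9 * ?Q^9)"
    by (simp only: ring_distribs diff_divide_distrib) (simp add: mult_ac)
  also have "\<dots> = (- 1 / 24 * y ^ 6 + 7 / 480 * y ^ 4 - 31 / 2688 * y ^ 2 + 127 / 7680 + y ^ 8 / 2) * (?Q^9 * ?W^2)
      - (- 1 / 24 * ?Q ^ 6 + 7 / 480 * ?Q ^ 4 - 31 / 2688 * ?Q ^ 2 + 127 / 7680 + ?Q ^ 8 / 2) * (y^9 * ?W^2)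
      - 2 * (y^9 * ?Q^9)"
    unfolding u v w by simp
  also have "\<dots> = (127/7680 + 1651/7680 * y + 523/420 * y^2 + 56659/13440 * y^3
    + 246199/26880 * y^4 + 352643/26880 * y^5 + 163103/13440 * y^6 + 2555/384 * y^7 + 2555/1536 * y^8)"
    by (simp add: algebra_simps eval_nat_numeral add_divide_distrib diff_divide_distrib)
  finally show ?thesis .
qed

text \<open>As for \<open>rem3_diff\<close>, with the gap taken in the opposite direction so that
  its derivative is again nonpositive.\<close>

lemma rem4_diff:
  fixes x :: real
  assumes "x > 0"
  shows "rem4 x - rem4 (x + 1) \<le> (ln (x + 1) - ln x) / 2 - 1 / (2 * x + 1)"
proof -
  define f where "f y = (ln (y + 1) - ln y) / 2 - 1 / (2 * y + 1) - (rem4 y - rem4 (y + 1))" for y :: real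
  define f' where "f' y = - (127/7680 + 1651/7680 * y + 523/420 * y^2 + 56659/13440 * y^3
    + 246199/26880 * y^4 + 352643/26880 * y^5 + 163103/13440 * y^6 + 2555/384 * y^7 + 2555/1536 * y^8)
    / (y^9 * (y + 1)^9 * (2 * y + 1)^2)" for y :: real
  have "f x \<ge> 0"
  proof (rule nonneg_of_deriv_nonpos_tendsto_0[where f = f and f' = f' and x = x])
    show "(f \<longlongrightarrow> 0) at_top" unfolding f_def rem3_def rem4_def by real_asymp
  next
    fix y :: real assume "y \<ge> x"
    then have y: "y > 0" using assms by simp
    have "127/7680 + 1651/7680 * y + 523/420 * y^2 + 56659/13440 * y^3
    + 246199/26880 * y^4 + 352643/26880 * y^5 + 163103/13440 * y^6 + 2555/384 * y^7 + 2555/1536 * y^8 \<ge> 0"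
      using y by (intro add_nonneg_nonneg mult_nonneg_nonneg zero_le_power) auto
    then show "f' y \<le> 0" using y unfolding f'_def by (intro divide_nonpos_nonneg) (simp only: neg_le_0_iff_le, simp)
    define u v w where uvw: "u = 1 / y" "v = 1 / (y + 1)" "w = 1 / (2 * y + 1)"
    have inv: "u * y = 1" "v * (y + 1) = 1" "w * (2 * y + 1) = 1" using y by (auto simp: uvw)
    have "(f has_real_derivative - ((- 1 / 24 * u ^ 3 + 7 / 480 * u ^ 5 - 31 / 2688 * u ^ 7 + 127 / 7680 * u ^ 9)
      - (- 1 / 24 * v ^ 3 + 7 / 480 * v ^ 5 - 31 / 2688 * v ^ 7 + 127 / 7680 * v ^ 9)
      - (v - u) / 2 - 2 * w ^ 2)) (at y)"
      unfolding f_def uvw using y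
      by (auto intro!: derivative_eq_intros DERIV_rem4 iffD1[OF DERIV_shift, OF DERIV_rem4]
          simp: power2_eq_square diff_divide_distrib) (simp add: divide_simps)
    also have "- ((- 1 / 24 * u ^ 3 + 7 / 480 * u ^ 5 - 31 / 2688 * u ^ 7 + 127 / 7680 * u ^ 9)
      - (- 1 / 24 * v ^ 3 + 7 / 480 * v ^ 5 - 31 / 2688 * v ^ 7 + 127 / 7680 * v ^ 9)
      - (v - u) / 2 - 2 * w ^ 2) = f' y"
    proof -
      have "(y^9 * (y + 1)^9 * (2 * y + 1)^2) \<noteq> 0" using y by auto
      then show ?thesis using rem4_deriv_numerator[OF inv] unfolding f'_def
        by (simp only: eq_divide_eq mult_minus_left simp_thms if_True)
    qed
    finally show "(f has_real_derivative f' y) (at y)" .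
  qed
  then show ?thesis by (simp add: f_def)
qed

text \<open>The one-step inequalities telescope from \<open>m\<close> to infinity, where both sides
  vanish.\<close>

lemma odd_harm_rem_le:
  assumes "m > 0"
  shows "odd_harm_rem m \<le> rem3 (real m)"
proof (rule le_of_diff_le_tendsto_0[where g = "\<lambda>m. rem3 (real m)"])
  show "(\<lambda>m. rem3 (real m)) \<longlonglongrightarrow> 0" unfolding rem3_def by real_asymp
  show "odd_harm_rem k - odd_harm_rem (Suc k) \<le> rem3 (real k) - rem3 (real (Suc k))" if "k \<ge> m" for k
    using odd_harm_rem_diff[of k] rem3_diff[of "real k"] assms that by (simp add: add.commute)
qed (rule odd_harm_rem_tendsto_0)

lemma odd_harm_rem_ge:
  assumes "m > 0"
  shows "rem4 (real m) \<le> odd_harm_rem m"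
proof (rule le_of_diff_le_tendsto_0[where f = "\<lambda>m. rem4 (real m)"])
  show "(\<lambda>m. rem4 (real m)) \<longlonglongrightarrow> 0" unfolding rem4_def rem3_def by real_asymp
  show "rem4 (real k) - rem4 (real (Suc k)) \<le> odd_harm_rem k - odd_harm_rem (Suc k)" if "k \<ge> m" for k
    using odd_harm_rem_diff[of k] rem4_diff[of "real k"] assms that by (simp add: add.commute)
qed (rule odd_harm_rem_tendsto_0)

section \<open>Moments of the Fourier series\<close>

text \<open>The Fourier series times \<open>x ^ q\<close> is integrated term by term; the M-test
  applies with majorant \<open>pi ^ q / w k\<close>. For even \<open>q\<close> the integrals on the
  left are polynomials in \<open>1 / (Suc k)\<^sup>2\<close> without constant term, so these
  identities determine the sums of inverse powers.\<close>

lemma moment_fourier_sums: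
  "(\<lambda>k. integral {0..pi} (\<lambda>x. x ^ q * cos (2 * real (Suc k) * x)) / (4 * (real (Suc k))\<^sup>2 - 1))
     sums integral {0..pi} (\<lambda>x. x ^ q * (1/2 - pi/4 * sin x))"
proof -
  define w where "w k = 4 * (real (Suc k))\<^sup>2 - 1" for k
  have wpos: "w k > 0" for k unfolding w_def by (rule four_square_minus_one) simp
  define t where "t k x = x ^ q * (cos (2 * real (Suc k) * x) / w k)" for k and x :: real
  have "uniform_limit {0..pi} (\<lambda>n x. \<Sum>k<n. t k x) (\<lambda>x. \<Sum>k. t k x) sequentially"
  proof (rule Weierstrass_m_test)
    show "norm (t k x) \<le> pi ^ q * (1 / w k)" if "x \<in> {0..pi}" for k x
    proof -
      have "\<bar>x ^ q\<bar> \<le> pi ^ q" using that by (simp add: power_mono)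
      moreover have "\<bar>cos (2 * real (Suc k) * x) / w k\<bar> \<le> 1 / w k"
        using wpos[of k] by (simp add: abs_div divide_right_mono)
      ultimately show ?thesis unfolding t_def real_norm_def abs_mult by (intro mult_mono) auto
    qed
    show "summable (\<lambda>k. pi ^ q * (1 / w k))"
      unfolding w_def by (intro summable_mult sums_summable[OF sums_inverse_four_square])
  qed
  moreover have "(\<Sum>k. t k x) = x ^ q * (1/2 - pi/4 * \<bar>sin x\<bar>)" for x
    unfolding t_def w_def
    using suminf_mult[OF summable_cos_four_square[of "\<lambda>k. 2 * real (Suc k) * x"], of "x ^ q"] fourier_abs_sin[of x]
    by simp
  ultimately have ul: "uniform_limit {0..pi} (\<lambda>n x. \<Sum>k<n. t k x) (\<lambda>x. x ^ q * (1/2 - pi/4 * \<bar>sin x\<bar>)) sequentially"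
    by simp
  have cont: "continuous_on {0..pi} (\<lambda>x. \<Sum>k<n. t k x)" for n
    unfolding t_def using wpos by (intro continuous_intros) (auto simp: less_imp_neq[symmetric])
  obtain I J where IJ: "\<And>n. ((\<lambda>x. \<Sum>k<n. t k x) has_integral I n) {0..pi}"
      "((\<lambda>x. x ^ q * (1/2 - pi/4 * \<bar>sin x\<bar>)) has_integral J) {0..pi}" "I \<longlonglongrightarrow> J"
    using uniform_limit_integral[OF ul cont] by auto
  have "I = (\<lambda>n. \<Sum>k<n. integral {0..pi} (\<lambda>x. x ^ q * cos (2 * real (Suc k) * x)) / w k)"
  proof
    fix n
    have "((\<lambda>x. \<Sum>k<n. t k x) has_integral
        (\<Sum>k<n. integral {0..pi} (\<lambda>x. x ^ q * cos (2 * real (Suc k) * x)) / w k)) {0..pi}"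
    proof (intro has_integral_sum)
      fix k
      have "(\<lambda>x. x ^ q * cos (2 * real (Suc k) * x)) integrable_on {0..pi}"
        by (intro integrable_continuous_real continuous_intros)
      from has_integral_divide[OF integrable_integral[OF this], of "w k"]
      show "(t k has_integral integral {0..pi} (\<lambda>x. x ^ q * cos (2 * real (Suc k) * x)) / w k) {0..pi}"
        by (simp add: t_def[abs_def])
    qed simp
    with IJ(1) show "I n = (\<Sum>k<n. integral {0..pi} (\<lambda>x. x ^ q * cos (2 * real (Suc k) * x)) / w k)"
      by (rule has_integral_unique)
  qed
  moreover have "J = integral {0..pi} (\<lambda>x. x ^ q * (1/2 - pi/4 * sin x))"
  proof -
    have "J = integral {0..pi} (\<lambda>x. x ^ q * (1/2 - pi/4 * \<bar>sin x\<bar>))"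
      using IJ(2) by (simp add: integral_unique)
    also have "\<dots> = integral {0..pi} (\<lambda>x. x ^ q * (1/2 - pi/4 * sin x))"
      by (intro integral_cong) (simp add: sin_ge_zero)
    finally show ?thesis .
  qed
  ultimately show ?thesis using IJ(3) unfolding sums_def w_def by (simp only:)
qed

section \<open>Recursions for the moments of cosine and sine\<close>

lemma moment_cos_0: "integral {0..pi} (\<lambda>x. x ^ 0 * cos (2 * real (Suc k) * x)) = 0"
proof -
  have "((\<lambda>x. cos (2 * real (Suc k) * x)) has_integral
      sin (2 * real (Suc k) * pi) / (2 * real (Suc k)) - sin (2 * real (Suc k) * 0) / (2 * real (Suc k))) {0..pi}"
    by (intro fundamental_theorem_of_calculus)
       (auto intro!: derivative_eq_intros simp: has_real_derivative_iff_has_vector_derivative[symmetric])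
  moreover have "sin (2 * real (Suc k) * pi) = 0"
    using sin_npi[of "2 * Suc k"] by (simp add: algebra_simps)
  ultimately show ?thesis by (simp add: integral_unique)
qed

lemma moment_cos_Suc_Suc:
  "integral {0..pi} (\<lambda>x. x ^ (q + 2) * cos (2 * real (Suc k) * x))
   = real (q + 2) * pi ^ (q + 1) / (2 * real (Suc k))\<^sup>2
     - real (q + 2) * real (q + 1) / (2 * real (Suc k))\<^sup>2 * integral {0..pi} (\<lambda>x. x ^ q * cos (2 * real (Suc k) * x))"
proof -
  define a where "a = 2 * real (Suc k)"
  have a: "a > 0" by (simp add: a_def)
  have api: "sin (a * pi) = 0" "cos (a * pi) = 1"
    using sin_npi[of "2 * Suc k"] cos_npi[of "2 * Suc k"] by (simp_all add: a_def algebra_simps)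
  \<comment> \<open>Two integrations by parts in one antiderivative. At \<open>pi\<close> the first
    summand vanishes because \<open>sin (a * pi) = 0\<close>; at 0 both vanish.\<close>
  define F where "F x = x ^ (q + 2) * sin (a * x) / a + real (q + 2) * x ^ (q + 1) * cos (a * x) / a\<^sup>2" for x
  have "((\<lambda>x. x ^ (q + 2) * cos (a * x) + real (q + 2) * real (q + 1) / a\<^sup>2 * (x ^ q * cos (a * x)))
      has_integral F pi - F 0) {0..pi}"
  proof (rule fundamental_theorem_of_calculus)
    fix x assume "x \<in> {0..pi}"
    have d1: "((\<lambda>x. x ^ (q + 2)) has_real_derivative real (q + 2) * x ^ (q + 1)) (at x within {0..pi})"
      using DERIV_pow[of "q + 2" x "{0..pi}"] by simp
    have d2: "((\<lambda>x. x ^ (q + 1)) has_real_derivative real (q + 1) * x ^ q) (at x within {0..pi})"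
      using DERIV_pow[of "q + 1" x "{0..pi}"] by simp
    have d3: "((\<lambda>x. sin (a * x)) has_real_derivative a * cos (a * x)) (at x within {0..pi})"
      by (auto intro!: derivative_eq_intros)
    have d4: "((\<lambda>x. cos (a * x)) has_real_derivative - a * sin (a * x)) (at x within {0..pi})"
      by (auto intro!: derivative_eq_intros)
    have "(F has_real_derivative
        (x ^ (q + 2) * cos (a * x) + real (q + 2) * real (q + 1) / a\<^sup>2 * (x ^ q * cos (a * x)))) (at x within {0..pi})"
      unfolding F_def[abs_def]
      by (rule DERIV_cong[OF DERIV_add[OF DERIV_cdivide[OF DERIV_mult[OF d1 d3]]
            DERIV_cdivide[OF DERIV_mult[OF DERIV_cmult[OF d2] d4]]]])
        (use a in \<open>simp add: field_simps power2_eq_square\<close>)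
    then show "(F has_vector_derivative
        (x ^ (q + 2) * cos (a * x) + real (q + 2) * real (q + 1) / a\<^sup>2 * (x ^ q * cos (a * x)))) (at x within {0..pi})"
      by (simp add: has_real_derivative_iff_has_vector_derivative)
  qed simp
  moreover have "F pi - F 0 = real (q + 2) * pi ^ (q + 1) / a\<^sup>2"
    by (simp add: F_def api)
  moreover have int: "(\<lambda>x. x ^ m * cos (a * x)) integrable_on {0..pi}" for m
    by (intro integrable_continuous_real continuous_intros)
  have "((\<lambda>x. x ^ (q + 2) * cos (a * x) + real (q + 2) * real (q + 1) / a\<^sup>2 * (x ^ q * cos (a * x)))
      has_integral integral {0..pi} (\<lambda>x. x ^ (q + 2) * cos (a * x))
        + real (q + 2) * real (q + 1) / a\<^sup>2 * integral {0..pi} (\<lambda>x. x ^ q * cos (a * x))) {0..pi}"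
    by (intro has_integral_add has_integral_mult_right integrable_integral int)
  ultimately show ?thesis unfolding a_def[symmetric]
    by (metis (no_types, lifting) has_integral_unique eq_diff_eq)
qed

lemma moment_sin_0: "integral {0..pi} (\<lambda>x::real. x ^ 0 * sin x) = 2"
proof -
  have "((\<lambda>x. sin x) has_integral (- cos pi - - cos 0)) {0..pi}"
    by (intro fundamental_theorem_of_calculus)
       (auto intro!: derivative_eq_intros simp: has_real_derivative_iff_has_vector_derivative[symmetric])
  then show ?thesis by (simp add: integral_unique)
qed

lemma moment_sin_Suc_Suc:
  "integral {0..pi} (\<lambda>x::real. x ^ (q + 2) * sin x)
   = pi ^ (q + 2) - real (q + 2) * real (q + 1) * integral {0..pi} (\<lambda>x. x ^ q * sin x)"
proof -
  define F where "F x = - (x ^ (q + 2) * cos x) + real (q + 2) * x ^ (q + 1) * sin x" for x :: real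
  have "((\<lambda>x. x ^ (q + 2) * sin x + real (q + 2) * real (q + 1) * (x ^ q * sin x))
      has_integral F pi - F 0) {0..pi}"
  proof (rule fundamental_theorem_of_calculus)
    fix x :: real assume "x \<in> {0..pi}"
    have d1: "((\<lambda>x. x ^ (q + 2)) has_real_derivative real (q + 2) * x ^ (q + 1)) (at x within {0..pi})"
      using DERIV_pow[of "q + 2" x "{0..pi}"] by simp
    have d2: "((\<lambda>x. x ^ (q + 1)) has_real_derivative real (q + 1) * x ^ q) (at x within {0..pi})"
      using DERIV_pow[of "q + 1" x "{0..pi}"] by simp
    have d3: "(sin has_real_derivative cos x) (at x within {0..pi})"
      by (auto intro!: derivative_eq_intros)
    have d4: "(cos has_real_derivative - sin x) (at x within {0..pi})"
      by (auto intro!: derivative_eq_intros)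
    have "(F has_real_derivative
        (x ^ (q + 2) * sin x + real (q + 2) * real (q + 1) * (x ^ q * sin x))) (at x within {0..pi})"
      unfolding F_def[abs_def]
      by (rule DERIV_cong[OF DERIV_add[OF DERIV_minus[OF DERIV_mult[OF d1 d4]]
            DERIV_mult[OF DERIV_cmult[OF d2] d3]]])
        (simp add: algebra_simps)
    then show "(F has_vector_derivative
        (x ^ (q + 2) * sin x + real (q + 2) * real (q + 1) * (x ^ q * sin x))) (at x within {0..pi})"
      by (simp add: has_real_derivative_iff_has_vector_derivative)
  qed simp
  moreover have "F pi - F 0 = pi ^ (q + 2)"
    by (simp add: F_def)
  moreover have int: "(\<lambda>x. x ^ m * sin x) integrable_on {0..pi}" for m
    by (intro integrable_continuous_real continuous_intros)
  have "((\<lambda>x. x ^ (q + 2) * sin x + real (q + 2) * real (q + 1) * (x ^ q * sin x))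
      has_integral integral {0..pi} (\<lambda>x. x ^ (q + 2) * sin x)
        + real (q + 2) * real (q + 1) * integral {0..pi} (\<lambda>x. x ^ q * sin x)) {0..pi}"
    by (intro has_integral_add has_integral_mult_right integrable_integral int)
  ultimately show ?thesis
    by (metis (no_types, lifting) has_integral_unique eq_diff_eq)
qed

lemma moment_fourier:
  "integral {0..pi} (\<lambda>x. x ^ q * (1/2 - pi/4 * sin x))
   = pi ^ Suc q / (2 * real (Suc q)) - pi/4 * integral {0..pi} (\<lambda>x. x ^ q * sin x)"
proof -
  have "((\<lambda>x. x ^ q * (1/2)) has_integral (pi ^ Suc q / (2 * real (Suc q)) - 0 ^ Suc q / (2 * real (Suc q)))) {0..pi}"
    by (intro fundamental_theorem_of_calculus)
       (auto intro!: derivative_eq_intros simp: has_real_derivative_iff_has_vector_derivative[symmetric] field_simps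
             simp del: power_Suc of_nat_Suc)
  moreover have "(\<lambda>x::real. x ^ q * sin x) integrable_on {0..pi}"
    by (intro integrable_continuous_real continuous_intros)
  from has_integral_mult_right[OF integrable_integral[OF this], of "pi/4"]
  have "((\<lambda>x. pi/4 * (x ^ q * sin x)) has_integral pi/4 * integral {0..pi} (\<lambda>x. x ^ q * sin x)) {0..pi}" .
  ultimately have "((\<lambda>x. x ^ q * (1/2) - pi/4 * (x ^ q * sin x)) has_integral
      (pi ^ Suc q / (2 * real (Suc q)) - 0 ^ Suc q / (2 * real (Suc q)) - pi/4 * integral {0..pi} (\<lambda>x. x ^ q * sin x))) {0..pi}"
    by (rule has_integral_diff)
  then have "((\<lambda>x. x ^ q * (1/2 - pi/4 * sin x)) has_integral
      (pi ^ Suc q / (2 * real (Suc q)) - pi/4 * integral {0..pi} (\<lambda>x. x ^ q * sin x))) {0..pi}"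
    by (simp add: algebra_simps)
  then show ?thesis by (rule integral_unique)
qed

text \<open>The values of the sums over k >= 1 of 1/((4k^2-1) k^(2j)) for j = 1, 2, 3. Each is 4
  times the one before minus zeta(2j), starting from 1/2 at j = 0.\<close>

abbreviation "S1 \<equiv> 2 - pi\<^sup>2 / 6"
abbreviation "S2 \<equiv> 8 - 2 * pi\<^sup>2 / 3 - pi ^ 4 / 90"
abbreviation "S3 \<equiv> 32 - 8 * pi\<^sup>2 / 3 - 2 * pi ^ 4 / 45 - pi ^ 6 / 945"

text \<open>The even moments form a triangular system: \<open>M q k\<close> involves the inverse
  powers of \<open>n k\<close> up to \<open>q\<close>. Solving it for the highest power gives the
  sums one after the other from the moments 2, 4 and 6.\<close>

lemma sums_inverse_powers:
  shows sums_inverse_power_2: "(\<lambda>k. 1 / ((4 * (real (Suc k))\<^sup>2 - 1) * real (Suc k) ^ 2)) sums S1" (is ?t2)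
    and sums_inverse_power_4: "(\<lambda>k. 1 / ((4 * (real (Suc k))\<^sup>2 - 1) * real (Suc k) ^ 4))
      sums S2" (is ?t4)
    and sums_inverse_power_6: "(\<lambda>k. 1 / ((4 * (real (Suc k))\<^sup>2 - 1) * real (Suc k) ^ 6))
      sums S3" (is ?t6)
proof -
  define w where "w k = 4 * (real (Suc k))\<^sup>2 - 1" for k
  have wpos: "w k > 0" for k unfolding w_def by (rule four_square_minus_one) simp
  define M where "M q k = integral {0..pi} (\<lambda>x. x ^ q * cos (2 * real (Suc k) * x))" for q k
  define J where "J q = integral {0..pi} (\<lambda>x::real. x ^ q * sin x)" for q
  have J0: "J 0 = 2" using moment_sin_0 by (simp add: J_def)
  have J2: "J 2 = pi ^ 2 - 4" using moment_sin_Suc_Suc[of 0] J0 by (simp add: J_def power2_eq_square)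
  have J4: "J 4 = pi ^ 4 - 12 * J 2" using moment_sin_Suc_Suc[of 2] by (simp add: J_def)
  have J6: "J 6 = pi ^ 6 - 30 * J 4" using moment_sin_Suc_Suc[of 4] by (simp add: J_def)
  have M0: "M 0 k = 0" for k using moment_cos_0[of k] by (simp add: M_def)
  define n where "n k = real (Suc k)" for k
  have n: "n k > 0" for k by (simp add: n_def)
  have rec: "M (q + 2) k = real (q + 2) * pi ^ (q + 1) / (2 * n k)\<^sup>2
      - real (q + 2) * real (q + 1) / (2 * n k)\<^sup>2 * M q k" for q k
    unfolding M_def n_def by (rule moment_cos_Suc_Suc)
  have M2: "M 2 k = pi / 2 / n k ^ 2" for k
    using rec[of 0 k] M0[of k] by (simp add: power_mult_distrib numeral_2_eq_2)
  have M4: "M 4 k = pi ^ 3 / n k ^ 2 - 3 * pi / 2 / n k ^ 4" for k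
    using rec[of 2 k] M2[of k] n[of k] by (simp add: power_mult_distrib eval_nat_numeral)
  have M6: "M 6 k = 3 / 2 * pi ^ 5 / n k ^ 2 - 15 / 2 * pi ^ 3 / n k ^ 4 + 45 / 4 * pi / n k ^ 6" for k
  proof -
    have "M 6 k = 6 * pi ^ 5 / (2 * n k)\<^sup>2 - 30 / (2 * n k)\<^sup>2 * M 4 k" using rec[of 4 k] by simp
    then show ?thesis
      using n[of k] unfolding M4 by (simp add: power_mult_distrib eval_nat_numeral algebra_simps)
  qed
  have T: "(\<lambda>k. M q k / w k) sums (pi ^ Suc q / (2 * real (Suc q)) - pi/4 * J q)" for q
    using moment_fourier_sums[of q] unfolding M_def w_def J_def moment_fourier .
  define p where "p q k = 1 / (w k * n k ^ q)" for q k
  have eq2: "p 2 = (\<lambda>k. 2 / pi * (M 2 k / w k))"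
    by (simp add: fun_eq_iff p_def M2 mult.commute)
  have s2: "p 2 sums (2 - pi\<^sup>2 / 6)"
  proof -
    have "2 / pi * (pi ^ Suc 2 / (2 * real (Suc 2)) - pi/4 * J 2) = 2 - pi\<^sup>2 / 6"
      unfolding J2 by (simp add: field_simps eval_nat_numeral)
    then show ?thesis using sums_mult[OF T[of 2], of "2 / pi"] unfolding eq2 by (simp only:)
  qed
  have eq4: "p 4 = (\<lambda>k. 2 / (3 * pi) * (pi ^ 3 * p 2 k - M 4 k / w k))"
  proof
    fix k
    show "p 4 k = 2 / (3 * pi) * (pi ^ 3 * p 2 k - M 4 k / w k)"
      unfolding p_def M4 using n[of k] wpos[of k] by (simp add: add_divide_distrib diff_divide_distrib eval_nat_numeral algebra_simps)
  qed
  have s4: "p 4 sums (8 - 2 * pi\<^sup>2 / 3 - pi ^ 4 / 90)"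
  proof -
    have "2 / (3 * pi) * (pi ^ 3 * (2 - pi\<^sup>2 / 6) - (pi ^ Suc 4 / (2 * real (Suc 4)) - pi/4 * J 4))
        = 8 - 2 * pi\<^sup>2 / 3 - pi ^ 4 / 90"
      unfolding J4 J2 by (simp add: field_simps eval_nat_numeral)
    then show ?thesis
      using sums_mult[OF sums_diff[OF sums_mult[OF s2, of "pi ^ 3"] T[of 4]], of "2 / (3 * pi)"]
      unfolding eq4 by (simp only:)
  qed
  have eq6: "p 6 = (\<lambda>k. 4 / (45 * pi) * (M 6 k / w k - 3 / 2 * pi ^ 5 * p 2 k + 15 / 2 * pi ^ 3 * p 4 k))"
  proof
    fix k
    show "p 6 k = 4 / (45 * pi) * (M 6 k / w k - 3 / 2 * pi ^ 5 * p 2 k + 15 / 2 * pi ^ 3 * p 4 k)"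
      unfolding p_def M6 using n[of k] wpos[of k] by (simp add: add_divide_distrib diff_divide_distrib eval_nat_numeral algebra_simps)
  qed
  have s6: "p 6 sums (32 - 8 * pi\<^sup>2 / 3 - 2 * pi ^ 4 / 45 - pi ^ 6 / 945)"
  proof -
    have "4 / (45 * pi) * (pi ^ Suc 6 / (2 * real (Suc 6)) - pi/4 * J 6 - 3 / 2 * pi ^ 5 * (2 - pi\<^sup>2 / 6)
        + 15 / 2 * pi ^ 3 * (8 - 2 * pi\<^sup>2 / 3 - pi ^ 4 / 90))
        = 32 - 8 * pi\<^sup>2 / 3 - 2 * pi ^ 4 / 45 - pi ^ 6 / 945"
      unfolding J6 J4 J2 by (simp add: field_simps eval_nat_numeral)
    then show ?thesis
      using sums_mult[OF sums_add[OF sums_diff[OF T[of 6] sums_mult[OF s2, of "3 / 2 * pi ^ 5"]]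
          sums_mult[OF s4, of "15 / 2 * pi ^ 3"]], of "4 / (45 * pi)"]
      unfolding eq6 by (simp only:)
  qed
  show ?t2 ?t4 ?t6 using s2 s4 s6 unfolding p_def[abs_def] w_def n_def by simp_all
qed

section \<open>Szego's formula\<close>

text \<open>Telescoping with sin(A-B) sin(A+B) = sin^2 A - sin^2 B for A = (p+1)u and B =
  pu.\<close>

lemma sin_squared_eq_sum: "(sin (real p * u))\<^sup>2 = sin u * (\<Sum>j<p. sin ((2 * real j + 1) * u))"
proof (induction p)
  case 0
  show ?case by simp
next
  case (Suc p)
  have a: "real (Suc p) * u = real p * u + u" "(2 * real p + 1) * u = (real p * u + u) + real p * u"
    by (simp_all add: algebra_simps)
  have "sin u = sin ((real p * u + u) - real p * u)" by simp
  then have "sin u * sin ((2 * real p + 1) * u) = sin ((real p * u + u) - real p * u) * sin ((real p * u + u) + real p * u)"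
    by (simp only: a)
  also have "\<dots> = (sin (real p * u + u))\<^sup>2 * (cos (real p * u))\<^sup>2 - (cos (real p * u + u))\<^sup>2 * (sin (real p * u))\<^sup>2"
    unfolding sin_add[of "real p * u + u"] sin_diff[of "real p * u + u"] by (simp add: algebra_simps power2_eq_square)
  also have "\<dots> = (sin (real p * u + u))\<^sup>2 - (sin (real p * u))\<^sup>2"
    unfolding cos_squared_eq by (simp add: algebra_simps)
  finally have "sin u * sin ((2 * real p + 1) * u) = (sin (real (Suc p) * u))\<^sup>2 - (sin (real p * u))\<^sup>2"
    by (simp only: a)
  then show ?case using Suc by (simp add: distrib_left del: of_nat_Suc)
qed

text \<open>Supplies the uniform bound \<open>n + 1\<close> on the integrand of
  \<open>L_half n\<close>, needed for monotone convergence.\<close>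

lemma abs_sin_mult_le: "\<bar>sin (real p * u)\<bar> \<le> real p * \<bar>sin u\<bar>"
proof (induction p)
  case 0
  show ?case by simp
next
  case (Suc p)
  have "\<bar>sin (real (Suc p) * u)\<bar> = \<bar>sin (real p * u) * cos u + cos (real p * u) * sin u\<bar>"
    using sin_add[of "real p * u" u] by (simp add: algebra_simps)
  also have "\<dots> \<le> \<bar>sin (real p * u)\<bar> * \<bar>cos u\<bar> + \<bar>cos (real p * u)\<bar> * \<bar>sin u\<bar>"
    by (metis abs_mult abs_triangle_ineq)
  also have "\<dots> \<le> \<bar>sin (real p * u)\<bar> * 1 + 1 * \<bar>sin u\<bar>"
    by (intro add_mono mult_mono) auto
  finally show ?case using Suc by (simp add: distrib_right)
qed

text \<open>Subtracting the cosine series from its value at 0 turns the terms into squares. They are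
  nonnegative, so the partial sums increase.\<close>

lemma fourier_abs_sin_squares:
  "(\<lambda>k. 8 / pi * ((sin (real (Suc k) * x))\<^sup>2 / (4 * (real (Suc k))\<^sup>2 - 1))) sums \<bar>sin x\<bar>"
proof -
  have "(\<lambda>k. cos (2 * real (Suc k) * x) / (4 * (real (Suc k))\<^sup>2 - 1)) sums (1/2 - pi/4 * \<bar>sin x\<bar>)"
    using summable_sums[OF summable_cos_four_square[of "\<lambda>k. 2 * real (Suc k) * x"]]
    unfolding fourier_abs_sin .
  from sums_mult[OF sums_diff[OF sums_inverse_four_square this], of "4 / pi"]
  have "(\<lambda>k. 4 / pi * (1 / (4 * (real (Suc k))\<^sup>2 - 1) - cos (2 * real (Suc k) * x) / (4 * (real (Suc k))\<^sup>2 - 1)))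
      sums \<bar>sin x\<bar>" by simp
  moreover have "4 / pi * (1 / (4 * (real (Suc k))\<^sup>2 - 1) - cos (2 * real (Suc k) * x) / (4 * (real (Suc k))\<^sup>2 - 1))
     = 8 / pi * ((sin (real (Suc k) * x))\<^sup>2 / (4 * (real (Suc k))\<^sup>2 - 1))" for k
    using cos_double_sin[of "real (Suc k) * x"]
    by (simp add: mult.assoc flip: diff_divide_distrib del: of_nat_Suc)
  ultimately show ?thesis by (simp only:)
qed

text \<open>The integrand is even, and on \<open>{0..pi}\<close> it is a sum of sines of frequency
  \<open>a = (2 * j + 1) / 2\<close>, each with integral \<open>1 / a\<close>.\<close>

lemma has_integral_sin_squared_quotient:
  "((\<lambda>t. (sin (real p * t / 2))\<^sup>2 / \<bar>sin (t / 2)\<bar>) has_integral 4 * odd_harm p) {-pi..pi}"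
proof -
  define h where "h t = (sin (real p * t / 2))\<^sup>2 / \<bar>sin (t / 2)\<bar>" for t :: real
  have "((\<lambda>t. \<Sum>j<p. sin ((2 * real j + 1) * (t / 2))) has_integral (\<Sum>j<p. 2 / (2 * real j + 1))) {0..pi}"
  proof (intro has_integral_sum)
    fix j
    define a where "a = (2 * real j + 1) / 2"
    have a: "a > 0" by (simp add: a_def)
    have "((\<lambda>t. sin (a * t)) has_integral (- cos (a * pi) / a - - cos (a * 0) / a)) {0..pi}"
      using a by (intro fundamental_theorem_of_calculus)
       (auto intro!: derivative_eq_intros simp: has_real_derivative_iff_has_vector_derivative[symmetric])
    moreover have "cos (a * pi) = 0"
    proof -
      have "a * pi = real j * pi + pi / 2" by (simp add: a_def field_simps)
      then show ?thesis by (simp add: cos_add)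
    qed
    ultimately show "((\<lambda>t. sin ((2 * real j + 1) * (t / 2))) has_integral 2 / (2 * real j + 1)) {0..pi}"
      by (simp add: a_def)
  qed simp
  also have "(\<Sum>j<p. 2 / (2 * real j + 1)) = 2 * odd_harm p"
    by (simp add: odd_harm_def sum_distrib_left)
  finally have pos: "(h has_integral 2 * odd_harm p) {0..pi}"
  \<comment> \<open>At \<open>t = 0\<close> both integrands are 0, the quotient because
    \<open>x / 0 = 0\<close>.\<close>
  proof (rule has_integral_eq[rotated])
    fix t assume t: "t \<in> {0..pi}"
    have "sin (t / 2) \<ge> 0" using t by (intro sin_ge_zero) auto
    moreover have "sin (t / 2) = 0 \<Longrightarrow> t = 0"
      using t sin_gt_zero[of "t / 2"] by (cases "t = 0") auto
    ultimately show "(\<Sum>j<p. sin ((2 * real j + 1) * (t / 2))) = h t"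
      using sin_squared_eq_sum[of p "t / 2"] by (cases "t = 0") (auto simp: h_def)
  qed
  have "((\<lambda>t. h (- t)) has_integral 2 * odd_harm p) {-pi..-0}"
    using pos by (subst has_integral_reflect_real) auto
  moreover have "(\<lambda>t. h (- t)) = h" by (auto simp: h_def)
  ultimately have neg: "(h has_integral 2 * odd_harm p) {-pi..0}" by simp
  have "(h has_integral 2 * odd_harm p + 2 * odd_harm p) {-pi..pi}"
    by (rule has_integral_combine[OF _ _ neg pos]) auto
  then show ?thesis by (simp add: h_def[abs_def])
qed

text \<open>The partial sums \<open>f K\<close> of the series of squares, divided by
  \<open>\<bar>sin (t / 2)\<bar>\<close>, increase to the integrand \<open>g\<close>. Monotone
  convergence therefore allows termwise integration.\<close>

lemma L_half_sums:
  "(\<lambda>k. odd_harm (Suc k * Suc n) / (4 * (real (Suc k))\<^sup>2 - 1)) sums (pi\<^sup>2 / 16 * L_half n)"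
proof -
  define w where "w k = 4 * (real (Suc k))\<^sup>2 - 1" for k
  have wpos: "w k > 0" for k unfolding w_def by (rule four_square_minus_one) simp
  define g where "g t = \<bar>sin ((real n + 1) * t / 2) / sin (t / 2)\<bar>" for t :: real
  define a where "a k t = 8 / pi / w k * ((sin (real (Suc k * Suc n) * t / 2))\<^sup>2 / \<bar>sin (t / 2)\<bar>)" for k t
  define f where "f K t = (\<Sum>k<K. a k t)" for K t
  have a_nonneg: "a k t \<ge> 0" for k t using wpos[of k] by (simp add: a_def)
  have g_sums: "(\<lambda>k. a k t) sums g t" for t
  proof -
    have "(\<lambda>k. 8 / pi * ((sin (real (Suc k) * ((real n + 1) * t / 2)))\<^sup>2 / w k) / \<bar>sin (t / 2)\<bar>) sums g t"
      using sums_divide[OF fourier_abs_sin_squares, of "(real n + 1) * t / 2" "\<bar>sin (t / 2)\<bar>"]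
      by (simp add: g_def w_def abs_divide)
    moreover have "8 / pi * ((sin (real (Suc k) * ((real n + 1) * t / 2)))\<^sup>2 / w k) / \<bar>sin (t / 2)\<bar> = a k t" for k
    proof -
      have "real (Suc k) * ((real n + 1) * t / 2) = real (Suc k * Suc n) * t / 2"
        by (simp add: algebra_simps)
      then show ?thesis unfolding a_def by (simp only:) simp
    qed
    ultimately show ?thesis by (simp only:)
  qed
  have g_le: "g t \<le> real n + 1" for t
  proof (cases "sin (t / 2) = 0")
    case False
    then show ?thesis
      using abs_sin_mult_le[of "Suc n" "t / 2"] by (simp add: g_def abs_divide divide_le_eq add.commute)
  qed (simp add: g_def)
  have f_int: "(f K has_integral (\<Sum>k<K. 8 / pi / w k * (4 * odd_harm (Suc k * Suc n)))) {-pi..pi}" for K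
    unfolding f_def a_def
    by (intro has_integral_sum has_integral_mult_right has_integral_sin_squared_quotient) simp
  have f_le: "f K t \<le> g t" for K t
    unfolding f_def using sum_le_suminf[OF sums_summable[OF g_sums]] a_nonneg sums_unique[OF g_sums]
    by (metis finite_lessThan)
  have "g integrable_on {-pi..pi} \<and> ((\<lambda>K. integral {-pi..pi} (f K)) \<longlonglongrightarrow> integral {-pi..pi} g)"
  proof (rule monotone_convergence_increasing)
    show "f K integrable_on {-pi..pi}" for K using f_int by blast
    show "f K t \<le> f (Suc K) t" for K t using a_nonneg by (simp add: f_def)
    show "(\<lambda>K. f K t) \<longlonglongrightarrow> g t" for t using g_sums[of t] by (simp add: sums_def f_def)
    have "\<bar>integral {-pi..pi} (f K)\<bar> \<le> (real n + 1) * (2 * pi)" for K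
    proof -
      have "f K t \<ge> 0" for t using a_nonneg by (auto simp: f_def intro!: sum_nonneg)
      moreover have "f K t \<le> real n + 1" for t using f_le[of K t] g_le[of t] by linarith
      ultimately have "norm (integral (cbox (-pi) pi) (f K)) \<le> (real n + 1) * measure lborel (cbox (-pi) pi)"
        by (intro integrable_bound) (use f_int in auto)
      then show ?thesis by simp
    qed
    then show "bounded (range (\<lambda>K. integral {-pi..pi} (f K)))"
      unfolding bounded_iff by auto
  qed
  then have "(\<lambda>K. \<Sum>k<K. 8 / pi / w k * (4 * odd_harm (Suc k * Suc n))) \<longlonglongrightarrow> integral {-pi..pi} g"
    using integral_unique[OF f_int] by simp
  then have "(\<lambda>k. 8 / pi / w k * (4 * odd_harm (Suc k * Suc n))) sums (2 * pi * L_half n)"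
    by (simp add: sums_def L_half_def g_def[abs_def])
  from sums_mult[OF this, of "pi / 32"] show ?thesis
    by (simp add: w_def power2_eq_square mult.assoc del: of_nat_Suc mult_Suc mult_Suc_right)
qed

section \<open>Estimates of the remainder\<close>

text \<open>Since ln(kN) = ln k + ln N with N = n + 1, the main terms of Szego's series split into
  the series in \<open>c1\<close> and multiples of the sum 1/2 of the weights.\<close>

lemma odd_harm_rem_sums:
  "(\<lambda>k. odd_harm_rem (Suc k * Suc n) / (4 * (real (Suc k))\<^sup>2 - 1))
     sums (pi\<^sup>2 / 16 * (L_half n - 4 / pi\<^sup>2 * ln (real n + 1) - c1))"
proof -
  define w where "w k = 4 * (real (Suc k))\<^sup>2 - 1" for k
  have wpos: "w k > 0" for k unfolding w_def by (rule four_square_minus_one) simp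
  define e where "e k = odd_harm_rem (Suc k * Suc n) / w k" for k
  define G :: real where "G = ln (real n + 1) + euler_mascheroni + 2 * ln 2"
  have w_sums: "(\<lambda>k. 1 / w k) sums (1/2)" unfolding w_def by (rule sums_inverse_four_square)
  have L_sums: "(\<lambda>k. odd_harm (Suc k * Suc n) / w k) sums (pi\<^sup>2 / 16 * L_half n)"
    unfolding w_def by (rule L_half_sums)
  have "Bseq odd_harm_rem"
    using odd_harm_rem_tendsto_0 by (blast intro: convergent_imp_Bseq convergentI)
  then obtain B where B: "\<And>m. norm (odd_harm_rem m) \<le> B" by (auto simp: Bseq_def)
  have "summable e"
  proof (rule summable_comparison_test')
    show "summable (\<lambda>k. B * (1 / w k))" by (intro summable_mult sums_summable[OF w_sums])
    show "norm (e k) \<le> B * (1 / w k)" for k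
      using B[of "Suc k * Suc n"] wpos[of k] by (simp add: e_def abs_divide divide_right_mono)
  qed
  then have e_sums: "e sums suminf e" by (rule summable_sums)
  \<comment> \<open>Solved for the logarithm, the definition of the remainder also yields
    convergence of the series in \<open>c1\<close>, as a combination of three convergent
    ones.\<close>
  have ln_eq: "ln (real (Suc k)) / w k = 2 * (odd_harm (Suc k * Suc n) / w k - e k) - G * (1 / w k)" for k
  proof -
    have "ln (real (Suc k * Suc n)) = ln (real (Suc k)) + ln (real n + 1)"
      by (simp add: ln_mult add.commute del: mult_Suc mult_Suc_right)
    then show ?thesis using wpos[of k]
      unfolding e_def odd_harm_rem_def G_def by (simp add: field_simps del: mult_Suc mult_Suc_right of_nat_Suc)
  qed
  have "(\<lambda>k. ln (real (Suc k)) / w k) sums (2 * (pi\<^sup>2 / 16 * L_half n - suminf e) - G * (1/2))"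
    unfolding ln_eq by (intro sums_diff sums_mult L_sums e_sums w_sums)
  then have "(\<Sum>k. ln (real (Suc k)) / (4 * (real (Suc k))\<^sup>2 - 1))
      = 2 * (pi\<^sup>2 / 16 * L_half n - suminf e) - G * (1/2)"
    unfolding w_def by (rule sums_unique[symmetric])
  then have "suminf e = pi\<^sup>2 / 16 * (L_half n - 4 / pi\<^sup>2 * ln (real n + 1) - c1)"
    unfolding c1_def G_def by (simp add: algebra_simps add_divide_distrib del: of_nat_Suc)
  with e_sums have "e sums (pi\<^sup>2 / 16 * (L_half n - 4 / pi\<^sup>2 * ln (real n + 1) - c1))" by (simp only:)
  then show ?thesis unfolding e_def[abs_def] w_def .
qed

section \<open>Summation of the envelopes over all multiples of n + 1\<close>

definition rem3_sum :: "real \<Rightarrow> real" where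
  "rem3_sum x = S1 / (48 * x ^ 2) - 7 * S2 / (1920 * x ^ 4) + 31 * S3 / (16128 * x ^ 6)"

lemma rem3_sums:
  assumes "x > 0"
  shows "(\<lambda>k. rem3 (real (Suc k) * x) / (4 * (real (Suc k))\<^sup>2 - 1)) sums rem3_sum x"
proof -
  define w where "w k = 4 * (real (Suc k))\<^sup>2 - 1" for k
  define n where "n k = real (Suc k)" for k
  have wn: "w k > 0" "n k > 0" for k unfolding w_def n_def by (rule four_square_minus_one, simp_all)
  have "(\<lambda>k. 1 / (48 * x ^ 2) * (1 / (w k * n k ^ 2)) - 7 / (1920 * x ^ 4) * (1 / (w k * n k ^ 4))
      + 31 / (16128 * x ^ 6) * (1 / (w k * n k ^ 6)))
    sums (1 / (48 * x ^ 2) * S1 - 7 / (1920 * x ^ 4) * S2 + 31 / (16128 * x ^ 6) * S3)"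
    unfolding w_def n_def
    by (intro sums_add sums_diff sums_mult sums_inverse_powers)
  moreover have "1 / (48 * x ^ 2) * (1 / (w k * n k ^ 2)) - 7 / (1920 * x ^ 4) * (1 / (w k * n k ^ 4))
      + 31 / (16128 * x ^ 6) * (1 / (w k * n k ^ 6)) = rem3 (n k * x) / w k" for k
    using wn[of k] assms by (simp add: rem3_def power_mult_distrib add_divide_distrib diff_divide_distrib mult_ac)
  moreover have "1 / (48 * x ^ 2) * S1 - 7 / (1920 * x ^ 4) * S2 + 31 / (16128 * x ^ 6) * S3 = rem3_sum x"
    by (simp add: rem3_sum_def)
  ultimately show ?thesis by (simp only: w_def n_def)
qed

lemma odd_harm_rem_sum_le:
  "pi\<^sup>2 / 16 * (L_half n - 4 / pi\<^sup>2 * ln (real n + 1) - c1) \<le> rem3_sum (real n + 1)"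
proof (rule sums_le[OF _ odd_harm_rem_sums rem3_sums])
  fix k
  have "4 * (real (Suc k))\<^sup>2 - 1 > 0" by (rule four_square_minus_one) simp
  moreover have "real (Suc k * Suc n) = real (Suc k) * (real n + 1)" by (simp add: algebra_simps)
  ultimately show "odd_harm_rem (Suc k * Suc n) / (4 * (real (Suc k))\<^sup>2 - 1)
      \<le> rem3 (real (Suc k) * (real n + 1)) / (4 * (real (Suc k))\<^sup>2 - 1)"
    using odd_harm_rem_le[of "Suc k * Suc n"] by (intro divide_right_mono) (simp_all only:, simp_all)
qed simp

text \<open>The parameter \<open>d\<close> makes room for a sharper bound on the first term, without which the
  case \<open>n = 0\<close> of the theorem would not follow.\<close>

lemma odd_harm_rem_sum_ge:
  assumes "rem4 (real n + 1) + d \<le> odd_harm_rem (Suc n)"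
  shows "rem3_sum (real n + 1) - 127 / (61440 * (real n + 1) ^ 8) * S3 + d / 3
    \<le> pi\<^sup>2 / 16 * (L_half n - 4 / pi\<^sup>2 * ln (real n + 1) - c1)"
proof -
  define x where "x = real n + 1"
  have x: "x > 0" by (simp add: x_def)
  define w where "w k = 4 * (real (Suc k))\<^sup>2 - 1" for k
  have wpos: "w k > 0" for k unfolding w_def by (rule four_square_minus_one) simp
  \<comment> \<open>In the eighth-order term the inverse 8th power of \<open>Suc k\<close> is
    relaxed to the 6th, so that \<open>S3\<close> serves once more. The gain \<open>d\<close> enters
    divided by 3 because \<open>w 0 = 3\<close>.\<close>
  have lower: "(\<lambda>k. rem3 (real (Suc k) * x) / w k - 127 / (61440 * x ^ 8) * (1 / (w k * real (Suc k) ^ 6))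
      + (if k = 0 then d / 3 else 0)) sums (rem3_sum x - 127 / (61440 * x ^ 8) * S3 + d / 3)"
    unfolding w_def
    by (intro sums_add sums_diff sums_mult sums_inverse_powers rem3_sums x sums_single)
  have le: "rem3 (real (Suc k) * x) / w k - 127 / (61440 * x ^ 8) * (1 / (w k * real (Suc k) ^ 6))
      + (if k = 0 then d / 3 else 0) \<le> odd_harm_rem (Suc k * Suc n) / w k" for k
  proof -
    define m where "m = real (Suc k)"
    have m: "m \<ge> 1" by (simp add: m_def)
    have mx: "real (Suc k * Suc n) = m * x" by (simp add: x_def m_def algebra_simps)
    have "127 / (61440 * (m * x) ^ 8) / w k \<le> 127 / (61440 * x ^ 8) * (1 / (w k * m ^ 6))"
    proof -
      have "m ^ 6 \<le> m ^ 8" using m by (intro power_increasing) auto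
      then have "127 / (61440 * x ^ 8 * w k * m ^ 8) \<le> 127 / (61440 * x ^ 8 * w k * m ^ 6)"
        using m x wpos[of k] by (intro divide_left_mono mult_left_mono mult_pos_pos) auto
      then show ?thesis by (simp add: power_mult_distrib mult_ac)
    qed
    then have r: "rem3 (m * x) / w k - 127 / (61440 * x ^ 8) * (1 / (w k * m ^ 6)) \<le> rem4 (m * x) / w k"
      unfolding rem4_def by (simp add: diff_divide_distrib)
    have "rem4 (m * x) / w k + (if k = 0 then d / 3 else 0) \<le> odd_harm_rem (Suc k * Suc n) / w k"
    proof (cases "k = 0")
      case True
      then have "(rem4 (m * x) + d) / 3 \<le> odd_harm_rem (Suc k * Suc n) / 3"
        using assms by (simp add: m_def x_def add.commute)
      moreover have "w k = 3" using True by (simp add: w_def)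
      ultimately show ?thesis using True by (simp add: add_divide_distrib)
    next
      case False
      have "rem4 (real (Suc k * Suc n)) \<le> odd_harm_rem (Suc k * Suc n)" by (rule odd_harm_rem_ge) simp
      then show ?thesis using False wpos[of k] unfolding mx by (simp add: divide_right_mono)
    qed
    with r show ?thesis unfolding m_def by linarith
  qed
  show ?thesis
    unfolding x_def[symmetric] by (rule sums_le[OF le lower odd_harm_rem_sums[of n, folded w_def x_def]])
qed

text \<open>One step of the difference equation moves the estimate from 1 to 2, where
  \<open>rem4\<close> is far more accurate. The price is a lower bound for \<open>ln 2\<close>, from
  four terms of the series in odd powers of \<open>1/3\<close>.\<close>

lemma odd_harm_rem_1_ge: "rem4 1 + 11 / 10000 \<le> odd_harm_rem 1"
proof -
  have "odd_harm_rem 1 = ln 2 / 2 - 1 / 3 + odd_harm_rem 2"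
    using odd_harm_rem_diff[of 1] by (simp add: numeral_2_eq_2)
  moreover have "rem4 2 \<le> odd_harm_rem 2" using odd_harm_rem_ge[of 2] by simp
  moreover have "ln 2 \<ge> (6931 / 10000 :: real)"
  proof -
    define f :: "nat \<Rightarrow> real" where "f k = 2 * (1 / 3) ^ (2 * k + 1) / real (2 * k + 1)" for k
    have f: "f sums ln 2" using ln_series_quadratic[of "2 :: real"] by (simp add: f_def[abs_def])
    have "sum f {..<4} \<le> suminf f"
      by (intro sum_le_suminf sums_summable[OF f]) (auto simp: f_def)
    also have "suminf f = ln 2" using f by (rule sums_unique[symmetric])
    finally have "f 0 + f 1 + f 2 + f 3 \<le> ln 2" by (simp add: eval_nat_numeral)
    then show ?thesis by (simp add: f_def power_divide)
  qed
  ultimately show ?thesis by (simp add: rem4_def rem3_def)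
qed

section \<open>Numerical bounds for the constants\<close>

lemma pi_squared_bounds: "9.869604401 \<le> pi\<^sup>2" "pi\<^sup>2 \<le> 9.869604402"
proof -
  have "3.141592653588\<^sup>2 \<le> pi\<^sup>2" by (rule power_mono[OF pi_approx(1)]) simp
  then show "9.869604401 \<le> pi\<^sup>2" by (simp add: power2_eq_square)
  have "pi\<^sup>2 \<le> 3.1415926535899\<^sup>2" by (rule power_mono[OF pi_approx(2)]) simp
  then show "pi\<^sup>2 \<le> 9.869604402" by (simp add: power2_eq_square)
qed

lemma constants_bounds:
  shows rho1_bounds: "0 < rho1" "rho1 \<le> 0.012"
    and varrho1_bounds: "0 < varrho1" "varrho1 \<le> 0.167"
    and C1_ge: "0.0007 \<le> C1"
    and rem4_coeff_le: "16 / pi\<^sup>2 * (127 / 61440 * S3) \<le> 0.00113"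
proof -
  define q where "q = pi\<^sup>2"
  \<comment> \<open>With the powers of \<open>q\<close> as separate unknowns in known intervals,
    each bound is linear arithmetic. The intervals must be narrow: the numerator of
    \<open>C1\<close> is about 1.4e7, while its largest term exceeds 1.2e10.\<close>
  define q2 q3 q4 where q234: "q2 = q ^ 2" "q3 = q ^ 3" "q4 = q ^ 4"
  have q: "9.869604401 \<le> q" "q \<le> 9.869604402" using pi_squared_bounds by (simp_all add: q_def)
  have p: "pi ^ 4 = q2" "pi ^ 6 = q3" "pi ^ 8 = q4" by (simp_all add: q234 q_def flip: power_mult)
  have b2: "9.869604401 ^ 2 \<le> q2" "q2 \<le> 9.869604402 ^ 2"
    and b3: "9.869604401 ^ 3 \<le> q3" "q3 \<le> 9.869604402 ^ 3"
    and b4: "9.869604401 ^ 4 \<le> q4" "q4 \<le> 9.869604402 ^ 4"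
    unfolding q234 using q by (intro power_mono; simp)+
  note b = q b2[simplified, unfolded power_divide, simplified] b3[simplified, unfolded power_divide, simplified]
    b4[simplified, unfolded power_divide, simplified]
  show "0 < rho1" "rho1 \<le> 0.012"
    using q by (simp_all add: rho1_def flip: q_def) (simp add: divide_le_eq)
  \<comment> \<open>As \<open>q < 12\<close>, both signs are flipped to make the denominator
    positive; likewise for \<open>C1\<close> below.\<close>
  have v: "varrho1 = 7 * (720 - 60 * q - q2) / (600 * (12 - q))"
  proof -
    have "varrho1 = - (7 * (-720 + 60 * q + q2)) / - (600 * (-12 + q))"
      unfolding varrho1_def p q_def by (simp only: minus_divide_divide)
    then show ?thesis by (simp add: algebra_simps)
  qed
  show "0 < varrho1" unfolding v using b by (intro divide_pos_pos) auto
  show "varrho1 \<le> 0.167" unfolding v using b by (simp add: divide_le_eq)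
  have c: "C1 = (7515244800 - 1252540800 * q + 46937520 * q2 + 65640 * q3 + 23797 * q4)
      / (952560000 * (12 * q - q2))"
  proof -
    have "C1 = - (-7515244800 + 1252540800 * q - 46937520 * q2 - 65640 * q3 - 23797 * q4)
      / - (952560000 * q * (-12 + q))"
      unfolding C1_def p q_def by (simp only: minus_divide_divide)
    then show ?thesis by (simp add: algebra_simps q234 power2_eq_square)
  qed
  show "0.0007 \<le> C1"
  proof -
    have "12 * q - q2 > 0" using b by simp
    then show ?thesis unfolding c using b by (simp add: le_divide_eq)
  qed
  show "16 / pi\<^sup>2 * (127 / 61440 * S3) \<le> 0.00113"
    unfolding p q_def[symmetric] using b by (simp add: divide_le_eq)
qed

text \<open>\<open>MC1\<close> expands as a geometric series in
  \<open>- varrho1 / x\<^sup>2\<close>. Its first two terms are those of the scaled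
  \<open>rem3_sum\<close>, \<open>C1\<close> is the gap in the third, and the last summand is the
  tail of the geometric series in closed form.\<close>

lemma rem3_sum_eq:
  assumes "x > 0"
  shows "16 / pi\<^sup>2 * rem3_sum x - rho1 / (x\<^sup>2 + varrho1)
    = C1 / x ^ 6 + rho1 * varrho1 ^ 3 / (x ^ 6 * (x\<^sup>2 + varrho1))"
proof -
  define q where "q = pi\<^sup>2"
  have q: "0 < q" "q \<noteq> 12" using pi_squared_bounds by (auto simp: q_def)
  have p: "pi ^ 4 = q ^ 2" "pi ^ 6 = q ^ 3" "pi ^ 8 = q ^ 4" by (simp_all add: q_def flip: power_mult)
  \<comment> \<open>The facts \<open>h1\<close> and \<open>h2\<close> match the coefficients of the
    2nd and 4th inverse powers, which is what fixes \<open>rho1\<close> and \<open>varrho1\<close>;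
    \<open>h3\<close> identifies \<open>C1\<close> in the 6th.\<close>
  have h1: "16 / q * ((2 - q / 6) / 48) = rho1"
    unfolding rho1_def q_def[symmetric] using q by (simp add: field_simps)
  have rv: "rho1 * varrho1 = - 7 * (-720 + 60 * q + q ^ 2) / (10800 * q)"
    unfolding rho1_def varrho1_def p q_def[symmetric] using q by (simp add: divide_simps) (simp add: algebra_simps)
  have h2: "16 / q * (7 * (8 - 2 * q / 3 - q ^ 2 / 90) / 1920) = rho1 * varrho1"
    unfolding rv using q by (simp add: field_simps)
  have h3: "16 / q * (31 * (32 - 8 * q / 3 - 2 * q ^ 2 / 45 - q ^ 3 / 945) / 16128) = C1 + rho1 * varrho1 ^ 2"
  proof -
    have "rho1 * varrho1 ^ 2 = (rho1 * varrho1) * varrho1" by (simp add: power2_eq_square)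
    also have "\<dots> = - 49 * (-720 + 60 * q + q ^ 2) ^ 2 / (6480000 * q * (-12 + q))"
    proof -
      define u v where "u = -720 + 60 * q + q ^ 2" and "v = -12 + q"
      show ?thesis unfolding rv unfolding varrho1_def p q_def[symmetric] u_def[symmetric] v_def[symmetric]
        by (simp add: power2_eq_square mult_ac)
    qed
    finally have r: "rho1 * varrho1 ^ 2 = - 49 * (-720 + 60 * q + q ^ 2) ^ 2 / (6480000 * q * (-12 + q))" .
    show ?thesis unfolding r C1_def p q_def[symmetric] using q
      by (simp add: divide_simps) (simp add: algebra_simps eval_nat_numeral)
  qed
  have "16 / pi\<^sup>2 * rem3_sum x = 16 / q * ((2 - q / 6) / 48) / x ^ 2
      - 16 / q * (7 * (8 - 2 * q / 3 - q ^ 2 / 90) / 1920) / x ^ 4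
      + 16 / q * (31 * (32 - 8 * q / 3 - 2 * q ^ 2 / 45 - q ^ 3 / 945) / 16128) / x ^ 6"
    unfolding rem3_sum_def p q_def[symmetric] ring_distribs(1) right_diff_distrib by simp
  also have "\<dots> = rho1 / x ^ 2 - rho1 * varrho1 / x ^ 4 + (C1 + rho1 * varrho1 ^ 2) / x ^ 6"
    by (simp only: h1 h2 h3)
  finally have e: "16 / pi\<^sup>2 * rem3_sum x
      = rho1 / x ^ 2 - rho1 * varrho1 / x ^ 4 + (C1 + rho1 * varrho1 ^ 2) / x ^ 6" .
  have "rho1 / x ^ 2 - rho1 * varrho1 / x ^ 4 + rho1 * varrho1 ^ 2 / x ^ 6 - rho1 / (x\<^sup>2 + varrho1)
      = rho1 * varrho1 ^ 3 / (x ^ 6 * (x\<^sup>2 + varrho1))"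
  proof -
    have "x\<^sup>2 + varrho1 \<noteq> 0" using assms varrho1_bounds(1)
      by (metis add_pos_pos less_irrefl zero_less_power)
    then show ?thesis using assms
      by (simp add: divide_simps) (simp add: algebra_simps eval_nat_numeral)
  qed
  then show ?thesis unfolding e by (simp add: add_divide_distrib)
qed

section \<open>The two-sided estimate, with the lower bound split at n = 0\<close>

theorem theorem4:
  shows "C1 > 0 \<and>
    (\<forall>n::nat.
      C1 / (real n + 13 / 8) ^ 6 < L_half n - 4 / pi\<^sup>2 * ln (real n + 1) - c1 - MC1 n \<and>
      L_half n - 4 / pi\<^sup>2 * ln (real n + 1) - c1 - MC1 n < C1 / (real n + 5 / 8) ^ 6)"
proof (intro conjI allI)
  show C1: "C1 > 0" using C1_ge by simp
  fix n :: nat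
  define x where "x = real n + 1"
  define T where "T = L_half n - 4 / pi\<^sup>2 * ln (real n + 1) - c1"
  define R where "R = rho1 * varrho1 ^ 3 / (x ^ 6 * (x\<^sup>2 + varrho1))"
  have x: "x \<ge> 1" by (simp add: x_def)
  have R0: "R \<ge> 0" unfolding R_def using rho1_bounds(1) varrho1_bounds(1) x by simp
  have main: "16 / pi\<^sup>2 * rem3_sum x - MC1 n = C1 / x ^ 6 + R"
    using rem3_sum_eq[of x] x unfolding MC1_def R_def x_def by simp
  have T: "16 / pi\<^sup>2 * (pi\<^sup>2 / 16 * T) = T" by simp
  define A where "A = 16 / pi\<^sup>2 * (127 / 61440 * S3)"
  have A: "A \<le> 0.00113" unfolding A_def by (rule rem4_coeff_le)
  have lower: "C1 / x ^ 6 - A / x ^ 8 + 16 / pi\<^sup>2 * (d / 3) \<le> T - MC1 n"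
    if "rem4 x + d \<le> odd_harm_rem (Suc n)" for d
  proof -
    have "rem3_sum x - 127 / (61440 * x ^ 8) * S3 + d / 3 \<le> pi\<^sup>2 / 16 * T"
      using odd_harm_rem_sum_ge that unfolding x_def T_def by blast
    then have "16 / pi\<^sup>2 * (rem3_sum x - 127 / (61440 * x ^ 8) * S3 + d / 3) \<le> 16 / pi\<^sup>2 * (pi\<^sup>2 / 16 * T)"
      by (intro mult_left_mono) auto
    moreover have "16 / pi\<^sup>2 * (rem3_sum x - 127 / (61440 * x ^ 8) * S3 + d / 3)
        = 16 / pi\<^sup>2 * rem3_sum x - A / x ^ 8 + 16 / pi\<^sup>2 * (d / 3)"
    proof -
      have "16 / pi\<^sup>2 * (127 / (61440 * x ^ 8) * s) = 16 / pi\<^sup>2 * (127 / 61440 * s) / x ^ 8" for s by simp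
      then show ?thesis unfolding A_def distrib_left right_diff_distrib[of "16 / pi\<^sup>2" "rem3_sum x"] by simp
    qed
    ultimately show ?thesis using main R0 unfolding T by linarith
  qed
  have xn: "real n + 13 / 8 = x + 5 / 8" "real n + 5 / 8 = x - 3 / 8" by (simp_all add: x_def)
  show "C1 / (real n + 13 / 8) ^ 6 < L_half n - 4 / pi\<^sup>2 * ln (real n + 1) - c1 - MC1 n"
  proof (cases "n = 0")
    case True
    then have x1: "x = 1" by (simp add: x_def)
    \<comment> \<open>At \<open>x = 1\<close> the difference \<open>C1 - A\<close> is negative, so
      the gain \<open>d = 11/10000\<close> has to compensate. As (13/8)^6 > 18, it suffices that
      0.0007 * 17/18 + 0.00059 > 0.00113.\<close>
    have "16 / pi\<^sup>2 * (11 / 10000 / 3) \<ge> 0.00059"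
      using pi_squared_bounds by (simp add: le_divide_eq)
    then have "C1 - A + 0.00059 \<le> T - MC1 n"
      using lower[of "11 / 10000"] odd_harm_rem_1_ge True by (simp add: x1)
    moreover have "C1 / (real n + 13 / 8) ^ 6 \<le> C1 / 18"
      using C1 True by (intro divide_left_mono) (auto simp: power_divide)
    ultimately show ?thesis using A C1_ge unfolding T_def by simp
  next
    case False
    then have x2: "x \<ge> 2" by (simp add: x_def)
    have "rem4 (real (Suc n)) \<le> odd_harm_rem (Suc n)" by (rule odd_harm_rem_ge) simp
    then have "C1 / x ^ 6 - A / x ^ 8 \<le> T - MC1 n"
      using lower[of 0] by (simp add: x_def add.commute)
    moreover have "C1 / (x + 5 / 8) ^ 6 < C1 / x ^ 6 - A / x ^ 8"
    proof -
      \<comment> \<open>Bernoulli's inequality makes the shift by 5/8 linear in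
        \<open>1 / x\<close>. It remains to show
        \<open>A / x ^ 2 < C1 * 15 / (4 * x + 15)\<close>.\<close>
      have "1 + real 6 * (5 / (8 * x)) \<le> (1 + 5 / (8 * x)) ^ 6"
        using x by (intro Bernoulli_inequality) (smt (verit) divide_nonneg_nonneg)
      then have bern: "1 + 15 / (4 * x) \<le> (1 + 5 / (8 * x)) ^ 6" by simp
      have "x + 5 / 8 = x * (1 + 5 / (8 * x))" using x by (simp add: field_simps)
      then have "C1 / (x + 5 / 8) ^ 6 = C1 / x ^ 6 / (1 + 5 / (8 * x)) ^ 6"
        by (simp add: power_mult_distrib)
      also have "\<dots> \<le> C1 / x ^ 6 / (1 + 15 / (4 * x))"
      proof -
        have "0 < 1 + 15 / (4 * x)" using x by (intro add_pos_nonneg) auto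
        then show ?thesis using x C1 bern by (intro frac_le) auto
      qed
      also have "\<dots> = (C1 - C1 * 15 / (4 * x + 15)) / x ^ 6"
        using x by (simp add: field_simps)
      also have "\<dots> < (C1 - A / x ^ 2) / x ^ 6"
      proof -
        \<comment> \<open>Here \<open>0.0105 = 15 * 0.0007\<close>, and \<open>0.021\<close> is its
          double, to be absorbed by \<open>x \<ge> 2\<close>.\<close>
        have "A * (4 * x + 15) \<le> 0.00113 * (4 * x + 15)" using A x by (intro mult_right_mono) auto
        also have "\<dots> < 0.021 * x" using x2 by simp
        also have "\<dots> \<le> 0.0105 * x ^ 2" using x2 by (simp add: power2_eq_square)
        also have "\<dots> \<le> C1 * 15 * x ^ 2" using C1_ge x by (intro mult_right_mono) auto
        finally have "A / x ^ 2 < C1 * 15 / (4 * x + 15)"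
          using x by (simp add: divide_less_eq less_divide_eq)
        then show ?thesis using x by (intro divide_strict_right_mono) auto
      qed
      also have "\<dots> = C1 / x ^ 6 - A / x ^ 8"
        by (simp add: diff_divide_distrib flip: power_add)
      finally show ?thesis .
    qed
    ultimately show ?thesis unfolding xn T_def by linarith
  qed
  have "16 / pi\<^sup>2 * (pi\<^sup>2 / 16 * T) \<le> 16 / pi\<^sup>2 * rem3_sum x"
    using odd_harm_rem_sum_le[of n] unfolding x_def T_def by (intro mult_left_mono) auto
  then have "T - MC1 n \<le> C1 / x ^ 6 + R" using main unfolding T by linarith
  also have "\<dots> < C1 / (x - 3 / 8) ^ 6"
  proof -
    \<comment> \<open>The tail \<open>R\<close> is compared with the gain from the shift by 3/8:
      Bernoulli's inequality yields a relative gain of at least \<open>9 / (4 * x)\<close>, hence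
      the target \<open>C1 * 9 / 4\<close>.\<close>
    have "rho1 * varrho1 ^ 3 \<le> 0.012 * 0.167 ^ 3"
      using rho1_bounds varrho1_bounds by (intro mult_mono power_mono) auto
    then have small: "rho1 * varrho1 ^ 3 < C1 * 9 / 4" using C1_ge by (simp add: eval_nat_numeral)
    have "R = rho1 * varrho1 ^ 3 / (x\<^sup>2 + varrho1) / x ^ 6" by (simp add: R_def)
    also have "\<dots> \<le> rho1 * varrho1 ^ 3 / x / x ^ 6"
    proof -
      have "x \<le> x\<^sup>2 + varrho1" using x varrho1_bounds(1) self_le_power[of x 2] by simp
      then show ?thesis using x rho1_bounds(1) varrho1_bounds(1)
        by (intro divide_right_mono divide_left_mono) auto
    qed
    also have "\<dots> < C1 * 9 / 4 / x / x ^ 6"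
      using small x by (intro divide_strict_right_mono) auto
    finally have "C1 / x ^ 6 + R < C1 / x ^ 6 * (1 + 9 / (4 * x))"
      by (simp add: ring_distribs mult_ac)
    also have "\<dots> \<le> C1 / x ^ 6 * (1 + 3 / (8 * x - 3)) ^ 6"
    proof -
      have "1 + real 6 * (3 / (8 * x - 3)) \<le> (1 + 3 / (8 * x - 3)) ^ 6"
        using x by (intro Bernoulli_inequality) (smt (verit) divide_nonneg_nonneg)
      moreover have "9 / (4 * x) \<le> real 6 * (3 / (8 * x - 3))" using x by (simp add: field_simps)
      ultimately show ?thesis using C1 x by (intro mult_left_mono) auto
    qed
    also have "\<dots> = C1 / (x - 3 / 8) ^ 6"
    proof -
      have "x = (x - 3 / 8) * (1 + 3 / (8 * x - 3))" using x by (simp add: field_simps)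
      then have "x ^ 6 = (x - 3 / 8) ^ 6 * (1 + 3 / (8 * x - 3)) ^ 6"
        by (metis power_mult_distrib)
      moreover have "1 + 3 / (8 * x - 3) > 0" using x by (intro add_pos_nonneg) auto
      ultimately show ?thesis by simp
    qed
    finally show ?thesis .
  qed
  finally show "L_half n - 4 / pi\<^sup>2 * ln (real n + 1) - c1 - MC1 n < C1 / (real n + 5 / 8) ^ 6"
    unfolding xn T_def .
qed

end
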